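(* Let $a\in\mathbb Q_{>1}$ (resp. $a\in\mathbb Q_{>0}$ in the logarithmic case) and $\eta_0\in(0,1)$. The homomorphism $\tilde\pi^*$ induces a $K_0$-linear homomorphism $\tilde\pi^*:\mathcal R_K^{\eta_0}\to\mathcal O_{TS_k^{a,\ge\eta_0}}$ (resp. $\tilde\pi^*:\mathcal R_K^{\eta_0}\to\mathcal O_{TS_{k,\log}^{a,\ge\eta_0}}$) such that $\Delta^*\circ\tilde\pi^*=\mathrm{id}$; the same holds with $\ge\eta_0$ replaced by $\eta$ for any $\eta\in[\eta_0,1)$. Moreover, for every $g\in\mathcal O_{Z_k^\eta}$, $$|\tilde\pi^*(g)-g|_{TS_k^{a,\eta}}\le\eta^{a-1}|g|_{Z_k^\eta}\quad(a>1),\qquad |\tilde\pi^*(g)-g|_{TS_{k,\log}^{a,\eta}}\le\eta^{a}|g|_{Z_k^\eta}\quad(a>0);$$ in particular $|\tilde\pi^*(g)|_{TS_k^{a,\eta}}=|\tilde\pi^*(g)|_{TS_{k,\log}^{a,\eta}}=|g|_{Z_k^\eta}$. Furthermore, if $g\in\mathcal O_{Z_k^\eta}\cap\mathcal O_K[[S]]$, then $|\tilde\pi^*(g)-g|_{TS_k^{a,\eta}}\le\eta^a$.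
   Context: Let $\kappa_k$ be a field of characteristic $p$ with finite $p$-basis $\bar b_1,\dots,\bar b_m$; $\mathcal O_K$ its Cohen ring (complete DVR of characteristic $0$, maximal ideal $p\mathcal O_K$, residue field $\kappa_k$) with canonical lifts $B_j$ of $\bar b_j$; $K=\mathrm{Frac}\,\mathcal O_K$; $\kappa_0=\bigcap_n\kappa_k^{p^n}$, $\mathcal O_{K_0}=W(\kappa_0)\subseteq\mathcal O_K$, $K_0=\mathrm{Frac}\,\mathcal O_{K_0}$. There is a unique continuous $\mathcal O_{K_0}$-homomorphism $\tilde\pi^*:\mathcal O_K[[S]]\to\mathcal O_K[[S,\delta_0,\dots,\delta_m]]$ with $\tilde\pi^*(S)=S+\delta_0$, $\tilde\pi^*(B_j)=B_j+\delta_j$ ($1\le j\le m$), and $\tilde\pi^*(g)-g\in(\delta_1,\dots,\delta_m)\cdot g\cdot\mathcal O_K[[\delta_1,\dots,\delta_m]]$ for $g\in\mathcal O_K$. $\mathcal R_K^{\eta_0}$ is the ring of analytic functions on the annulus $Z_k^{\ge\eta_0}=A^1_K[\eta_0,1)$ (series $\sum_{i\in\mathbb Z}a_iS^i$, $a_i\in K$, convergent for $\eta_0\le|S|<1$); $Z_k^\eta=A^1_K[\eta,\eta]$ with $\eta$-Gauss norm $|\sum a_iS^i|_{Z_k^\eta}=\max_i|a_i|\eta^i$ and ring $\mathcal O_{Z_k^\eta}$. For rational $a>1$, $TS_k^{a,\ge\eta_0}=\{(S,\delta_0,\dots,\delta_m)\in A^{m+2}_K[0,1):|S|\ge\eta_0,\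 |\delta_j|\le|S|^a\ (0\le j\le m)\}$ and $TS_k^{a,\eta}=A^1_K[\eta,\eta]\times_KA^{m+1}_K[0,\eta^a]$; for rational $a>0$, $TS_{k,\log}^{a,\ge\eta_0}=\{|S|\ge\eta_0,\ |\delta_0|\le|S|^{a+1},\ |\delta_j|\le|S|^a\ (1\le j\le m)\}$ and $TS_{k,\log}^{a,\eta}=A^1_K[\eta,\eta]\times A^1_K[0,\eta^{a+1}]\times A^m_K[0,\eta^a]$. $\mathcal O_X$ denotes the ring of analytic functions on $X$, and $|\cdot|_{TS^{a,\eta}_k}$, $|\cdot|_{TS_{k,\log}^{a,\eta}}$ the Gauss norms on these products of annulus and polydiscs. $\mathcal R_K^{\eta_0}$ and $\mathcal O_{Z_k^\eta}$ are regarded as subrings of the thickening-space rings via $S\mapsto S$ (the projection $\pi^*$, an isometry), and $\Delta^*$ denotes restriction to the locus $\delta_0=\cdots=\delta_m=0$. *)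

theory Defs
  imports
    "HOL-Analysis.Analysis"
    "HOL-Algebra.Ring"
    "HOL-Library.Poly_Mapping"
    "HOL-Computational_Algebra.Primes"
begin

subsection \<open>The field \<open>K\<close>, its ring of integers and its residue field\<close>

text \<open>The library's \<open>norm\<close> is confined to real vector spaces, hence a new constant. Positivity
  and definiteness of \<open>absv\<close> are inherited from \<open>dist\<close>.\<close>

class complete_nonarch_field = field_char_0 + complete_space +
  fixes absv :: "'a \<Rightarrow> real"
  assumes dist_absv: "dist x y = absv (x - y)"
    and absv_mult: "absv (x * y) = absv x * absv y"
    and absv_add: "absv (x + y) \<le> max (absv x) (absv y)"

definition integers :: "'k::complete_nonarch_field set" where
  "integers = {x. absv x \<le> 1}"

text \<open>The monomials in \<open>b\<^sub>1, \<dots>, b\<^sub>m\<close> with exponents less than \<open>p\<close> form a basis of the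
  field over its subfield of \<open>p\<close>-th powers.\<close>

definition is_p_basis :: "nat \<Rightarrow> nat \<Rightarrow> (nat \<Rightarrow> 'r::field) \<Rightarrow> bool" where
  "is_p_basis p m b \<longleftrightarrow>
    (let E = {1..m} \<rightarrow>\<^sub>E {..<p} in
      \<forall>x. \<exists>!c. c \<in> E \<rightarrow>\<^sub>E range (\<lambda>y. y ^ p) \<and>
        x = (\<Sum>e\<in>E. c e * (\<Prod>j\<in>{1..m}. b j ^ e j)))"

text \<open>\<open>integers\<close> is a complete discrete valuation ring of characteristic \<open>0\<close> with maximal ideal
  generated by \<open>p\<close>; \<open>red\<close> (relevant on \<open>integers\<close> only) identifies its residue field with \<open>'r\<close>,
  and \<open>B\<^sub>j\<close> lifts \<open>b\<^sub>j\<close>. These data determine the Cohen ring of \<open>'r\<close> together with the lifts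
  up to unique isomorphism. The value of \<open>absv (of_nat p)\<close> in the open unit interval is not fixed.\<close>

locale cohen_ring =
  fixes p m :: nat
    and red :: "'k::complete_nonarch_field \<Rightarrow> 'r::field"
    and b :: "nat \<Rightarrow> 'r" and B :: "nat \<Rightarrow> 'k"
  assumes p_prime: "prime p"
    and residue_char: "CHAR('r) = p"
    and p_basis: "is_p_basis p m b"
    and maximal_ideal: "{x :: 'k. absv x < 1} = (*) (of_nat p) ` integers"
    and red_one: "red 1 = 1"
    and red_add: "\<lbrakk>x \<in> integers; y \<in> integers\<rbrakk> \<Longrightarrow> red (x + y) = red x + red y"
    and red_mult: "\<lbrakk>x \<in> integers; y \<in> integers\<rbrakk> \<Longrightarrow> red (x * y) = red x * red y"
    and red_eq_0_iff: "x \<in> integers \<Longrightarrow> red x = 0 \<longleftrightarrow> absv x < 1"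
    and red_surj: "red ` integers = UNIV"
    and lifts: "j \<in> {1..m} \<Longrightarrow> B j \<in> integers \<and> red (B j) = b j"

definition perfect_core :: "nat \<Rightarrow> 'r::field set" where
  "perfect_core p = (\<Inter>n. range (\<lambda>y. y ^ (p ^ n)))"

text \<open>\<open>t\<close> is the Teichmueller lift of \<open>x\<close>: it reduces to \<open>x\<close> and has all \<open>p\<close>-power roots. It exists
  and is unique for \<open>x \<in> perfect_core p\<close>.\<close>

definition is_teichmueller ::
  "nat \<Rightarrow> ('k::complete_nonarch_field \<Rightarrow> 'r::field) \<Rightarrow> 'r \<Rightarrow> 'k \<Rightarrow> bool" where
  "is_teichmueller p red x t \<longleftrightarrow>
    t \<in> integers \<and> red t = x \<and> (\<forall>n. \<exists>s\<in>integers. s ^ (p ^ n) = t)"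

text \<open>The image in \<open>integers\<close> of the Witt vectors of \<open>perfect_core p\<close>, as the set of all
  Teichmueller expansions.\<close>

definition witt_integers ::
  "nat \<Rightarrow> ('k::complete_nonarch_field \<Rightarrow> 'r::field) \<Rightarrow> 'k set" where
  "witt_integers p red =
    {y. \<exists>x t. (\<forall>n. x n \<in> perfect_core p \<and> is_teichmueller p red (x n) (t n)) \<and>
      (\<lambda>n. of_nat p ^ n * t n) sums y}"

definition witt_field ::
  "nat \<Rightarrow> ('k::complete_nonarch_field \<Rightarrow> 'r::field) \<Rightarrow> 'k set" where
  "witt_field p red = {x / y | x y. x \<in> witt_integers p red \<and> y \<in> witt_integers p red \<and> y \<noteq> 0}"

subsection \<open>Series in \<open>S\<close> and in \<open>S, \<delta>\<^sub>0, \<dots>, \<delta>\<^sub>m\<close>\<close>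

text \<open>\<open>f i\<close> is the coefficient of \<open>S\<^sup>i\<close>; \<open>F i n\<close> is the coefficient of \<open>S\<^sup>i \<delta>\<^sup>n\<close>, where \<open>\<delta>\<^sub>j\<close> has
  exponent \<open>lookup n j\<close>. Restriction between domains is the identity on coefficients.\<close>

type_synonym 'k series = "int \<Rightarrow> 'k"
type_synonym 'k thick_series = "int \<Rightarrow> (nat \<Rightarrow>\<^sub>0 nat) \<Rightarrow> 'k"

definition series_const :: "'k::complete_nonarch_field \<Rightarrow> 'k series" where
  "series_const c = (\<lambda>i. if i = 0 then c else 0)"

definition series_S :: "'k::complete_nonarch_field series" where
  "series_S = (\<lambda>i. if i = 1 then 1 else 0)"

definition series_scale :: "'k::complete_nonarch_field \<Rightarrow> 'k series \<Rightarrow> 'k series" where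
  "series_scale c f = (\<lambda>i. c * f i)"

definition series_ring :: "'k::complete_nonarch_field series set \<Rightarrow> 'k series ring" where
  "series_ring C =
    \<lparr>carrier = C,
     mult = (\<lambda>f g i. \<Sum>\<^sub>\<infinity>j. f j * g (i - j)),
     one = series_const 1,
     zero = (\<lambda>i. 0),
     add = (\<lambda>f g i. f i + g i)\<rparr>"

definition pi_star :: "'k::complete_nonarch_field series \<Rightarrow> 'k thick_series" where
  "pi_star f = (\<lambda>i n. if n = 0 then f i else 0)"

definition Delta_star :: "'k::complete_nonarch_field thick_series \<Rightarrow> 'k series" where
  "Delta_star F = (\<lambda>i. F i 0)"

definition thick_delta :: "nat \<Rightarrow> 'k::complete_nonarch_field thick_series" where
  "thick_delta j = (\<lambda>i n. if i = 0 \<and> n = Poly_Mapping.single j 1 then 1 else 0)"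

definition thick_add ::
  "'k::complete_nonarch_field thick_series \<Rightarrow> 'k thick_series \<Rightarrow> 'k thick_series" where
  "thick_add F G = (\<lambda>i n. F i n + G i n)"

definition thick_scale ::
  "'k::complete_nonarch_field \<Rightarrow> 'k thick_series \<Rightarrow> 'k thick_series" where
  "thick_scale c F = (\<lambda>i n. c * F i n)"

definition thick_mult ::
  "'k::complete_nonarch_field thick_series \<Rightarrow> 'k thick_series \<Rightarrow> 'k thick_series" where
  "thick_mult F G = (\<lambda>i n. \<Sum>\<^sub>\<infinity>j. \<Sum>(u, v) | u + v = n. F j u * G (i - j) v)"

definition thick_ring :: "'k::complete_nonarch_field thick_series set \<Rightarrow> 'k thick_series ring" where
  "thick_ring C =
    \<lparr>carrier = C,
     mult = thick_mult,
     one = pi_star (series_const 1),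
     zero = (\<lambda>i n. 0),
     add = thick_add\<rparr>"

subsection \<open>Formal power series over the integers and the homomorphism \<open>\<pi>\<close>-tilde\<close>

definition int_series :: "'k::complete_nonarch_field series set" where
  "int_series = {f. (\<forall>i. f i \<in> integers) \<and> (\<forall>i<0. f i = 0)}"

definition int_thick_series :: "nat \<Rightarrow> 'k::complete_nonarch_field thick_series set" where
  "int_thick_series m =
    {F. (\<forall>i n. F i n \<in> integers) \<and> (\<forall>i n. F i n \<noteq> 0 \<longrightarrow> i \<ge> 0 \<and> Poly_Mapping.keys n \<subseteq> {0..m})}"

definition int_delta_series :: "nat \<Rightarrow> 'k::complete_nonarch_field thick_series set" where
  "int_delta_series m =
    {F. (\<forall>i n. F i n \<in> integers) \<and> (\<forall>i n. F i n \<noteq> 0 \<longrightarrow> i = 0 \<and> Poly_Mapping.keys n \<subseteq> {1..m})}"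

text \<open>In \<open>continuous_on\<close> below, function types carry the product topology, which induces on
  \<open>int_series\<close> and \<open>int_thick_series m\<close> the topologies defined by the maximal ideals
  \<open>(p, S)\<close> and \<open>(p, S, \<delta>\<^sub>0, \<dots>, \<delta>\<^sub>m)\<close>.\<close>

definition is_pi_tilde ::
  "nat \<Rightarrow> nat \<Rightarrow> ('k::complete_nonarch_field \<Rightarrow> 'r::field) \<Rightarrow> (nat \<Rightarrow> 'k) \<Rightarrow>
    ('k series \<Rightarrow> 'k thick_series) \<Rightarrow> bool" where
  "is_pi_tilde p m red B P \<longleftrightarrow>
    P \<in> ring_hom (series_ring int_series) (thick_ring (int_thick_series m)) \<and>
    (\<forall>c\<in>witt_integers p red. \<forall>f\<in>int_series. P (series_scale c f) = thick_scale c (P f)) \<and>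
    continuous_on int_series P \<and>
    P series_S = thick_add (pi_star series_S) (thick_delta 0) \<and>
    (\<forall>j\<in>{1..m}. P (series_const (B j)) = thick_add (pi_star (series_const (B j))) (thick_delta j)) \<and>
    (\<forall>g\<in>integers. \<exists>H. (\<forall>j\<in>{1..m}. H j \<in> int_delta_series m) \<and>
      P (series_const g) - pi_star (series_const g) =
        (\<lambda>i n. \<Sum>j\<in>{1..m}. thick_mult (thick_delta j) (thick_scale g (H j)) i n))"

subsection \<open>Analytic functions on annuli and thickening spaces\<close>

text \<open>A domain is given by the absolute values of \<open>S\<close> and of the \<open>\<delta>\<^sub>j\<close> that it allows, and a
  series is analytic on it if its terms tend to \<open>0\<close> at all these radii. The set \<open>I\<close>
  of values for \<open>S\<close> is \<open>{\<eta>\<^sub>0..<1}\<close> for the spaces with superscript \<open>\<ge>\<eta>\<^sub>0\<close> and \<open>{\<eta>}\<close> for those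
  with superscript \<open>\<eta>\<close>. As \<open>0 < s < 1\<close> and \<open>a > 0\<close>, all radii in \<open>TS\<close> and \<open>TS_log\<close> below are less than \<open>1\<close>. The
  suprema defining the norms are finite for series in the corresponding rings.\<close>

definition annulus_ring :: "real set \<Rightarrow> 'k::complete_nonarch_field series ring" where
  "annulus_ring I =
    series_ring {f. \<forall>s\<in>I. ((\<lambda>i. absv (f i) * s powi i) \<longlongrightarrow> 0) cofinite}"

definition annulus_norm :: "real \<Rightarrow> 'k::complete_nonarch_field series \<Rightarrow> real" where
  "annulus_norm \<eta> f = (SUP i. absv (f i) * \<eta> powi i)"

definition thick_term ::
  "nat \<Rightarrow> real \<Rightarrow> (nat \<Rightarrow> real) \<Rightarrow> 'k::complete_nonarch_field thick_series \<Rightarrow>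
    int \<times> (nat \<Rightarrow>\<^sub>0 nat) \<Rightarrow> real" where
  "thick_term m s r F =
    (\<lambda>(i, n). absv (F i n) * s powi i * (\<Prod>j\<in>{0..m}. r j ^ Poly_Mapping.lookup n j))"

definition thick_gauss_norm ::
  "nat \<Rightarrow> real \<Rightarrow> (nat \<Rightarrow> real) \<Rightarrow> 'k::complete_nonarch_field thick_series \<Rightarrow> real" where
  "thick_gauss_norm m s r F = (SUP x. thick_term m s r F x)"

definition analytic_ring ::
  "nat \<Rightarrow> (real \<times> (nat \<Rightarrow> real)) set \<Rightarrow> 'k::complete_nonarch_field thick_series ring" where
  "analytic_ring m X =
    thick_ring {F. (\<forall>i n. F i n \<noteq> 0 \<longrightarrow> Poly_Mapping.keys n \<subseteq> {0..m}) \<and>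
      (\<forall>(s, r)\<in>X. (thick_term m s r F \<longlongrightarrow> 0) cofinite)}"

definition TS :: "nat \<Rightarrow> real \<Rightarrow> real set \<Rightarrow> (real \<times> (nat \<Rightarrow> real)) set" where
  "TS m a I = {(s, r). s \<in> I \<and> (\<forall>j\<in>{0..m}. 0 \<le> r j \<and> r j \<le> s powr a)}"

definition TS_log :: "nat \<Rightarrow> real \<Rightarrow> real set \<Rightarrow> (real \<times> (nat \<Rightarrow> real)) set" where
  "TS_log m a I =
    {(s, r). s \<in> I \<and> 0 \<le> r 0 \<and> r 0 \<le> s powr (a + 1) \<and>
      (\<forall>j\<in>{1..m}. 0 \<le> r j \<and> r j \<le> s powr a)}"

definition TS_norm :: "nat \<Rightarrow> real \<Rightarrow> real \<Rightarrow> 'k::complete_nonarch_field thick_series \<Rightarrow> real" where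
  "TS_norm m a \<eta> = thick_gauss_norm m \<eta> (\<lambda>j. \<eta> powr a)"

definition TS_log_norm :: "nat \<Rightarrow> real \<Rightarrow> real \<Rightarrow> 'k::complete_nonarch_field thick_series \<Rightarrow> real" where
  "TS_log_norm m a \<eta> =
    thick_gauss_norm m \<eta> (\<lambda>j. if j = 0 then \<eta> powr (a + 1) else \<eta> powr a)"

text \<open>\<open>\<Phi> : R \<rightarrow> T\<close> is a homomorphism, linear over the subfield \<open>K0\<close>, that extends \<open>P\<close> and is a
  section of \<open>Delta_star\<close>.\<close>

definition induced_hom ::
  "'k::complete_nonarch_field set \<Rightarrow> ('k series \<Rightarrow> 'k thick_series) \<Rightarrow>
    'k series ring \<Rightarrow> 'k thick_series ring \<Rightarrow> ('k series \<Rightarrow> 'k thick_series) \<Rightarrow> bool" where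
  "induced_hom K0 P R T \<Phi> \<longleftrightarrow>
    \<Phi> \<in> ring_hom R T \<and>
    (\<forall>c\<in>K0. \<forall>g\<in>carrier R. \<Phi> (series_scale c g) = thick_scale c (\<Phi> g)) \<and>
    (\<forall>g\<in>int_series. \<Phi> g = P g) \<and>
    (\<forall>g\<in>carrier R. Delta_star (\<Phi> g) = g)"

end

theory Submission
  imports Defs "HOL-Computational_Algebra.Formal_Power_Series"
begin

text \<open>By the last condition of \<open>is_pi_tilde\<close>, \<open>\<pi>\<close>-tilde expands a constant \<open>x\<close> as a power series in \<open>\<delta>\<^sub>1, \<dots>, \<delta>\<^sub>m\<close>
  with constant term \<open>x\<close> and coefficients of absolute value at most \<open>|x|\<close>. Scaling by powers of \<open>p\<close> extends this
  from the integers to \<open>K\<close>. As \<open>S\<close> goes to \<open>S + \<delta>\<^sub>0\<close>, a Laurent series is sent to its Taylor expansion: the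
  coefficient of \<open>S\<^sup>i \<delta>\<^sup>n\<close> is \<open>k choose n\<^sub>0\<close> times the coefficient of the remaining part of \<open>\<delta>\<^sup>n\<close> in the expansion of
  the \<open>k\<close>-th coefficient, where \<open>k = i + n\<^sub>0\<close>. As binomial coefficients are integers, the Gauss norm of this
  term is at most that of the \<open>k\<close>-th term of the series times \<open>\<rho>\<close> to the degree of \<open>\<delta>\<^sup>n\<close>, where
  \<open>\<rho> = \<eta>\<^sup>a\<^sup>-\<^sup>1\<close>, respectively \<open>\<rho> = \<eta>\<^sup>a\<close>, is less than \<open>1\<close>. On integral power series the expansion agrees with
  \<open>\<pi>\<close>-tilde, by continuity of the latter.\<close>

section \<open>Fields with a complete nonarchimedean absolute value\<close>

lemma absv_nonneg [simp]: "0 \<le> absv (x :: 'k::complete_nonarch_field)"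
  by (metis diff_zero dist_absv zero_le_dist)

lemma absv_eq_0_iff [simp]: "absv (x :: 'k::complete_nonarch_field) = 0 \<longleftrightarrow> x = 0"
  by (metis diff_zero dist_absv dist_eq_0_iff)

lemma absv_0 [simp]: "absv (0 :: 'k::complete_nonarch_field) = 0"
  by simp

lemma absv_1 [simp]: "absv (1 :: 'k::complete_nonarch_field) = 1"
  by (metis absv_eq_0_iff absv_mult mult_cancel_left1 mult_1 zero_neq_one)

lemma absv_minus [simp]: "absv (- x) = absv (x :: 'k::complete_nonarch_field)"
proof -
  have "absv (0 - x) = absv (x - 0)"
    by (simp only: dist_absv[symmetric] dist_commute)
  then show ?thesis by simp
qed

lemma absv_sum_le:
  fixes f :: "'a \<Rightarrow> 'k::complete_nonarch_field"
  assumes "\<And>x. x \<in> A \<Longrightarrow> absv (f x) \<le> c" "0 \<le> c"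
  shows "absv (sum f A) \<le> c"
  using assms
proof (induction A rule: infinite_finite_induct)
  case (insert x A)
  have "absv (f x + sum f A) \<le> max (absv (f x)) (absv (sum f A))" by (rule absv_add)
  also have "\<dots> \<le> c" using insert by auto
  finally show ?case using insert by simp
qed auto

lemma absv_of_nat: "absv (of_nat n :: 'k::complete_nonarch_field) \<le> 1"
proof (induction n)
  case (Suc n)
  then show ?case using absv_add[of 1 "of_nat n :: 'k"] by auto
qed simp

lemma absv_of_int: "absv (of_int z :: 'k::complete_nonarch_field) \<le> 1"
  by (cases z rule: int_cases2) (auto simp: absv_of_nat)

text \<open>At integer arguments, negative ones included, generalized binomial coefficients are
  integers. Hence the expansion of \<open>(S + \<delta>\<^sub>0)\<^sup>k\<close> introduces no
  denominators, whatever the sign of \<open>k\<close>.\<close>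

lemma absv_gchoose: "absv ((of_int z gchoose n) :: 'k::complete_nonarch_field) \<le> 1"
  unfolding of_int_gbinomial[symmetric] by (rule absv_of_int)

lemma absv_power: "absv (x ^ n) = absv (x :: 'k::complete_nonarch_field) ^ n"
  by (induction n) (auto simp: absv_mult)

section \<open>Continuity of addition and infinite sums\<close>

instance complete_nonarch_field \<subseteq> topological_ab_group_add
proof
  fix a b :: 'a
  show "((\<lambda>x. fst x + snd x) \<longlongrightarrow> a + b) (nhds a \<times>\<^sub>F nhds b)"
  proof (rule tendstoI)
    fix e :: real assume e: "0 < e"
    have "dist (x + y) (a + b) < e" if "dist x a < e" "dist y b < e" for x y
      using that absv_add[of "x - a" "y - b"] by (simp add: dist_absv algebra_simps)
    moreover have "\<forall>\<^sub>F x in nhds a. dist x a < e" "\<forall>\<^sub>F y in nhds b. dist y b < e"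
      using e by (auto simp: eventually_nhds_metric)
    ultimately show "\<forall>\<^sub>F z in nhds a \<times>\<^sub>F nhds b. dist (fst z + snd z) (a + b) < e"
      unfolding eventually_prod_filter by (metis fst_conv snd_conv)
  qed
  show "(uminus \<longlongrightarrow> - a) (nhds a)"
  proof (rule tendstoI)
    fix e :: real assume e: "0 < e"
    have "dist (- x) (- a) = dist x a" for x
      using absv_minus[of "x - a"] by (simp add: dist_absv)
    then show "\<forall>\<^sub>F x in nhds a. dist (- x) (- a) < e"
      using e by (auto simp: eventually_nhds_metric)
  qed
qed

text \<open>A bounded additive map is continuous and so commutes with infinite sums. Additivity
  takes the place of linearity because the coefficient maps \<open>\<lambda>x. D x n\<close> below
  are in general only additive.\<close>

lemma has_sum_bounded_additive:
  fixes h :: "'k::complete_nonarch_field \<Rightarrow> 'k"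
  assumes add: "\<And>x y. h (x + y) = h x + h y"
    and bound: "\<And>x. absv (h x) \<le> C * absv x"
    and f: "(f has_sum s) A"
  shows "((\<lambda>j. h (f j)) has_sum h s) A"
proof -
  interpret additive h by (rule additive.intro) (rule add)
  have "h \<midarrow>s\<rightarrow> h s"
  proof (rule tendstoI)
    fix e :: real assume e: "0 < e"
    \<comment> \<open>\<open>C\<close> need not be positive, hence the divisor
      \<open>\<bar>C\<bar> + 1\<close>.\<close>
    define d where "d = e / (\<bar>C\<bar> + 1)"
    have d: "0 < d" using e by (simp add: d_def)
    have "dist (h x) (h s) < e" if "dist x s < d" for x
    proof -
      have "dist (h x) (h s) = absv (h (x - s))" by (simp add: dist_absv diff)
      also have "\<dots> \<le> C * absv (x - s)" by (rule bound)
      also have "\<dots> \<le> (\<bar>C\<bar> + 1) * absv (x - s)" by (intro mult_right_mono) auto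
      also have "\<dots> < (\<bar>C\<bar> + 1) * d"
        using that by (intro mult_strict_left_mono) (auto simp: dist_absv)
      also have "\<dots> = e" by (simp add: d_def)
      finally show ?thesis .
    qed
    then show "\<forall>\<^sub>F x in at s. dist (h x) (h s) < e"
      using d by (auto simp: eventually_at)
  qed
  from has_sum_comm_additive[OF additive_axioms this f] show ?thesis by (simp add: o_def)
qed

lemma has_sum_mult_left_nonarch:
  fixes c :: "'k::complete_nonarch_field"
  shows "(f has_sum s) A \<Longrightarrow> ((\<lambda>j. c * f j) has_sum c * s) A"
  by (rule has_sum_bounded_additive[where C = "absv c"]) (auto simp: algebra_simps absv_mult)

lemma has_sum_sum_nonarch:
  fixes f :: "'a \<Rightarrow> 'b \<Rightarrow> 'k::complete_nonarch_field"
  assumes "\<And>i. i \<in> I \<Longrightarrow> (f i has_sum s i) A"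
  shows "((\<lambda>j. \<Sum>i\<in>I. f i j) has_sum (\<Sum>i\<in>I. s i)) A"
  using assms
  by (induction I rule: infinite_finite_induct) (auto intro!: has_sum_add has_sum_0)

lemma infsum_single_support:
  fixes f :: "'a \<Rightarrow> 'k::complete_nonarch_field"
  assumes "\<And>j. j \<noteq> a \<Longrightarrow> f j = 0"
  shows "infsum f UNIV = f a"
  by (rule infsumI, rule has_sum_finite_neutralI[where B = "{a}"]) (use assms in auto)

text \<open>The sums over \<open>{j. |f j| \<ge> 1/(n+1)}\<close> form a Cauchy sequence by the ultrametric inequality.\<close>

lemma summable_on_if_tendsto_0:
  fixes f :: "'a \<Rightarrow> 'k::complete_nonarch_field"
  assumes "((\<lambda>j. absv (f j)) \<longlongrightarrow> 0) cofinite"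
  shows "f summable_on UNIV"
proof -
  define E where "E n = {j. absv (f j) \<ge> inverse (real (Suc n))}" for n
  define s where "s n = sum f (E n)" for n
  have fin: "finite (E n)" for n
  proof -
    have "\<forall>\<^sub>F j in cofinite. absv (f j) < inverse (real (Suc n))"
      using assms by (rule order_tendstoD) simp
    then show ?thesis by (simp add: E_def eventually_cofinite not_less)
  qed
  have est: "absv (sum f F - s n) \<le> inverse (real (Suc n))" if "finite F" "E n \<subseteq> F" for F n
  proof -
    have "sum f F - s n = sum f (F - E n)"
      unfolding s_def using that by (simp add: sum_diff)
    also have "absv \<dots> \<le> inverse (real (Suc n))"
      by (rule absv_sum_le) (auto simp: E_def)
    finally show ?thesis .
  qed
  have mono: "E n \<subseteq> E k" if "n \<le> k" for n k
    using that by (auto simp: E_def intro: order_trans[rotated] le_imp_inverse_le)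
  have small: "\<exists>N. \<forall>n\<ge>N. inverse (real (Suc n)) < e" if e: "0 < e" for e
  proof -
    obtain N where N: "inverse (real (Suc N)) < e" using reals_Archimedean[OF e] by auto
    have "inverse (real (Suc n)) \<le> inverse (real (Suc N))" if "N \<le> n" for n
      using that by (intro le_imp_inverse_le) auto
    with N show ?thesis by (meson le_less_trans)
  qed
  have "Cauchy s"
  proof (rule CauchyI')
    fix e :: real assume "0 < e"
    then obtain N where N: "\<forall>n\<ge>N. inverse (real (Suc n)) < e" using small by auto
    have "dist (s k) (s n) < e" if "N \<le> k" "k < n" for k n
    proof -
      have "dist (s k) (s n) = absv (s n - s k)"
        by (subst dist_commute) (rule dist_absv)
      also have "\<dots> \<le> inverse (real (Suc k))"
        using est[OF fin mono, of k n] that by (simp add: s_def)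
      finally show ?thesis using N that by (meson le_less_trans)
    qed
    then show "\<exists>M. \<forall>m\<ge>M. \<forall>n>m. dist (s m) (s n) < e" by auto
  qed
  then obtain L where L: "s \<longlonglongrightarrow> L" using Cauchy_convergent convergent_def by blast
  have "(f has_sum L) UNIV"
    unfolding has_sum_def
  proof (rule tendstoI)
    fix e :: real assume e: "0 < e"
    then obtain N where N: "\<forall>n\<ge>N. inverse (real (Suc n)) < e" using small by auto
    obtain M where M: "\<forall>n\<ge>M. dist (s n) L < e" using L e by (meson metric_LIMSEQ_D)
    define n where "n = max N M"
    have "dist (sum f F) L < e" if "finite F" "E n \<subseteq> F" for F
    proof -
      have "dist (sum f F) L \<le> max (absv (sum f F - s n)) (absv (s n - L))"
        using absv_add[of "sum f F - s n" "s n - L"] by (simp add: dist_absv)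
      moreover have "absv (sum f F - s n) < e"
        using est[OF that] N[rule_format, of n] by (simp add: n_def del: of_nat_Suc)
      moreover have "absv (s n - L) < e" using M by (simp add: n_def dist_absv[symmetric])
      ultimately show ?thesis by linarith
    qed
    then show "\<forall>\<^sub>F F in finite_subsets_at_top UNIV. dist (sum f F) L < e"
      using fin by (auto simp: eventually_finite_subsets_at_top)
  qed
  then show ?thesis by (auto simp: summable_on_def)
qed

section \<open>Exponents of the variables\<close>

text \<open>The exponent of \<open>\<delta>\<^sub>0\<close> is separated from the others because
  \<open>\<delta>\<^sub>0\<close> arises from expanding powers of
  \<open>S + \<delta>\<^sub>0\<close>, the remaining variables from expanding constants.\<close>

definition tail_exponent :: "(nat \<Rightarrow>\<^sub>0 nat) \<Rightarrow> (nat \<Rightarrow>\<^sub>0 nat)" where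
  "tail_exponent n = n - Poly_Mapping.single 0 (Poly_Mapping.lookup n 0)"

lemma lookup_tail_exponent:
  "Poly_Mapping.lookup (tail_exponent n) k = (if k = 0 then 0 else Poly_Mapping.lookup n k)"
  by (simp add: tail_exponent_def lookup_minus lookup_single)

lemma tail_exponent_0 [simp]: "tail_exponent 0 = 0"
  by (rule poly_mapping_eqI) (simp add: lookup_tail_exponent)

text \<open>Splitting \<open>n\<close> as \<open>u + v\<close> amounts to splitting the exponent of
  \<open>\<delta>\<^sub>0\<close> and the tail independently. This decouples the two in Cauchy
  products.\<close>

lemma sum_exponent_split:
  fixes h :: "nat \<Rightarrow> nat \<Rightarrow> (nat \<Rightarrow>\<^sub>0 nat) \<Rightarrow> (nat \<Rightarrow>\<^sub>0 nat) \<Rightarrow> 'b::comm_monoid_add"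
  shows "(\<Sum>(u, v) | u + v = n.
      h (Poly_Mapping.lookup u 0) (Poly_Mapping.lookup v 0) (tail_exponent u) (tail_exponent v)) =
    (\<Sum>k\<in>{0..Poly_Mapping.lookup n 0}. \<Sum>(u, v) | u + v = tail_exponent n.
      h k (Poly_Mapping.lookup n 0 - k) u v)"
proof -
  let ?N = "Poly_Mapping.lookup n 0"
  \<comment> \<open>Exponents are natural numbers, so a sum that vanishes at \<open>0\<close> has
    both summands vanishing there.\<close>
  have L: "Poly_Mapping.lookup u 0 = 0 \<and> Poly_Mapping.lookup v 0 = 0"
    if "u + v = tail_exponent n" for u v
    using arg_cong[OF that, of "\<lambda>w. Poly_Mapping.lookup w 0"]
    by (simp add: lookup_add lookup_tail_exponent)
  have "(\<Sum>(u, v) | u + v = n.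
      h (Poly_Mapping.lookup u 0) (Poly_Mapping.lookup v 0) (tail_exponent u) (tail_exponent v)) =
    (\<Sum>(k, u, v)\<in>{0..?N} \<times> {(u, v). u + v = tail_exponent n}. h k (?N - k) u v)"
  proof (rule sum.reindex_bij_witness[where
        j = "\<lambda>(u, v). (Poly_Mapping.lookup u 0, tail_exponent u, tail_exponent v)" and
        i = "\<lambda>(k, u, v). (u + Poly_Mapping.single 0 k, v + Poly_Mapping.single 0 (?N - k))"],
      goal_cases)
    case (1 x)
    then show ?case
      by (auto intro!: poly_mapping_eqI simp: lookup_add lookup_single lookup_tail_exponent when_def)
  next
    case (2 x)
    then show ?case
      by (auto intro!: poly_mapping_eqI simp: lookup_add lookup_tail_exponent)
  next
    case (3 x)
    then show ?case
      by (auto intro!: poly_mapping_eqI dest!: L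
        simp: lookup_add lookup_single lookup_tail_exponent when_def)
  next
    case (4 x)
    obtain k u v where x: "x = (k, u, v)" "k \<le> ?N" "u + v = tail_exponent n"
      using 4 by auto
    have "Poly_Mapping.lookup u i + Poly_Mapping.lookup v i =
        (if i = 0 then 0 else Poly_Mapping.lookup n i)" for i
      using arg_cong[OF x(3), of "\<lambda>w. Poly_Mapping.lookup w i"]
      by (simp add: lookup_add lookup_tail_exponent)
    then show ?case using x L[OF x(3)]
      by (auto intro!: poly_mapping_eqI simp: lookup_add lookup_single when_def)
  next
    case (5 x)
    then show ?case by (auto simp: lookup_add)
  qed
  also have "\<dots> = (\<Sum>k\<in>{0..?N}. \<Sum>(u, v) | u + v = tail_exponent n. h k (?N - k) u v)"
    by (simp add: sum.cartesian_product case_prod_unfold)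
  finally show ?thesis .
qed


text \<open>An exponent with keys in \<open>J\<close> is determined by its restriction to
  \<open>J\<close>, and a bound on the degree bounds each entry.\<close>

lemma finite_exponents_bounded:
  assumes "finite J"
  shows "finite {n :: nat \<Rightarrow>\<^sub>0 nat. Poly_Mapping.keys n \<subseteq> J \<and> (\<Sum>j\<in>J. Poly_Mapping.lookup n j) \<le> N}"
    (is "finite ?A")
proof -
  let ?r = "\<lambda>n. restrict (Poly_Mapping.lookup n) J"
  have "inj_on ?r ?A"
  proof (rule inj_onI, rule poly_mapping_eqI)
    fix u v k assume uv: "u \<in> ?A" "v \<in> ?A" "?r u = ?r v"
    show "Poly_Mapping.lookup u k = Poly_Mapping.lookup v k"
    proof (cases "k \<in> J")
      case True
      then show ?thesis using uv(3) by (metis restrict_apply')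
    next
      case False
      then have "k \<notin> Poly_Mapping.keys u" "k \<notin> Poly_Mapping.keys v" using uv by auto
      then show ?thesis by (simp add: in_keys_iff)
    qed
  qed
  moreover have "?r ` ?A \<subseteq> (\<Pi>\<^sub>E k\<in>J. {..N})"
  proof (clarsimp simp: PiE_iff)
    fix n k
    assume "(\<Sum>j\<in>J. Poly_Mapping.lookup n j) \<le> N" "k \<in> J"
    then show "Poly_Mapping.lookup n k \<le> N"
      using member_le_sum[of k J "Poly_Mapping.lookup n"] assms by simp
  qed
  ultimately show ?thesis
    by (meson assms finite_PiE finite_atMost finite_imageD finite_subset)
qed

section \<open>Taylor expansion of Laurent series\<close>

lemma tendsto_0_cofinite_iff:
  assumes "\<And>x. (0::real) \<le> f x"
  shows "(f \<longlongrightarrow> 0) cofinite \<longleftrightarrow> (\<forall>e>0. finite {x. e \<le> f x})"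
  using assms by (simp add: tendsto_iff eventually_cofinite not_less)

text \<open>All but finitely many values are less than \<open>1\<close>. The suprema that define the
  Gauss norms are finite for this reason.\<close>

lemma tendsto_0_cofinite_bdd_above:
  assumes "((f :: 'a \<Rightarrow> real) \<longlongrightarrow> 0) cofinite"
  shows "bdd_above (range f)"
proof -
  have "\<forall>\<^sub>F x in cofinite. f x < 1" using assms by (rule order_tendstoD) simp
  then have "finite {x. 1 \<le> f x}" by (simp add: eventually_cofinite not_less)
  then have "bdd_above (f ` {x. 1 \<le> f x} \<union> {..1})" by simp
  then show ?thesis by (rule bdd_above_mono) auto
qed

text \<open>\<open>D x n\<close> is the coefficient of \<open>\<delta>\<^sup>n\<close> in the image of the constant \<open>x\<close>.\<close>

locale constant_expansion =
  fixes m :: nat and D :: "'k::complete_nonarch_field \<Rightarrow> (nat \<Rightarrow>\<^sub>0 nat) \<Rightarrow> 'k"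
  assumes D_add: "D (x + y) n = D x n + D y n"
    and D_mult: "D (x * y) n = (\<Sum>(u, v) | u + v = n. D x u * D y v)"
    and D_bound: "absv (D x n) \<le> absv x"
    and D_exponent_0: "D x 0 = x"
    and D_one: "n \<noteq> 0 \<Longrightarrow> D 1 n = 0"
    and D_keys: "D x n \<noteq> 0 \<Longrightarrow> Poly_Mapping.keys n \<subseteq> {1..m}"
begin

lemma D_zero [simp]: "D 0 n = 0"
  using D_add[of 0 0 n] by simp

text \<open>The coefficient of \<open>S\<^sup>i \<delta>\<^sup>n\<close> in the sum of the \<open>D (f k) (S + \<delta>\<^sub>0)\<^sup>k\<close>, in which only \<open>k = i + n\<^sub>0\<close>
  contributes.\<close>

definition taylor :: "'k series \<Rightarrow> 'k thick_series" where
  "taylor f = (\<lambda>i n. let k = i + int (Poly_Mapping.lookup n 0) in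
    (of_int k gchoose Poly_Mapping.lookup n 0) * D (f k) (tail_exponent n))"

lemma taylor_exponent_0 [simp]: "taylor f i 0 = f i"
  by (simp add: taylor_def D_exponent_0)

lemma Delta_star_taylor: "Delta_star (taylor f) = f"
  by (simp add: Delta_star_def)

lemma taylor_add: "taylor (\<lambda>i. f i + g i) = thick_add (taylor f) (taylor g)"
  by (simp add: taylor_def thick_add_def D_add Let_def algebra_simps)

lemma taylor_scale:
  assumes "\<And>x (n :: nat \<Rightarrow>\<^sub>0 nat). D (c * x) n = c * D x n"
  shows "taylor (series_scale c f) = thick_scale c (taylor f)"
  by (simp add: taylor_def thick_scale_def series_scale_def assms Let_def algebra_simps)

text \<open>Only \<open>k = 0\<close> contributes: \<open>0 gchoose N\<close> excludes
  \<open>N > 0\<close>, and \<open>D_one\<close> excludes the other nonzero exponents.\<close>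

lemma taylor_one: "taylor (series_const 1) = pi_star (series_const 1)"
proof (intro ext)
  fix i and n :: "nat \<Rightarrow>\<^sub>0 nat"
  let ?N = "Poly_Mapping.lookup n 0"
  have "tail_exponent n \<noteq> 0" if "n \<noteq> 0" "?N = 0"
    using that by (simp add: tail_exponent_def)
  then show "taylor (series_const 1) i n = pi_star (series_const 1) i n"
    by (auto simp: taylor_def series_const_def pi_star_def D_one D_exponent_0 gbinomial_0_left Let_def
        simp del: of_int_add)
qed

lemma absv_taylor_le: "absv (taylor f i n) \<le> absv (f (i + int (Poly_Mapping.lookup n 0)))"
proof -
  have "absv (taylor f i n) \<le> 1 * absv (f (i + int (Poly_Mapping.lookup n 0)))"
    unfolding taylor_def Let_def absv_mult
    by (intro mult_mono D_bound absv_gchoose) auto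
  then show ?thesis by simp
qed

lemma taylor_keys:
  assumes "taylor f i n \<noteq> 0"
  shows "Poly_Mapping.keys n \<subseteq> {0..m}"
proof
  fix j assume j: "j \<in> Poly_Mapping.keys n"
  have "D (f (i + int (Poly_Mapping.lookup n 0))) (tail_exponent n) \<noteq> 0"
    using assms by (auto simp: taylor_def Let_def)
  from D_keys[OF this] show "j \<in> {0..m}"
    using j by (cases "j = 0") (auto simp: in_keys_iff lookup_tail_exponent subset_iff)
qed

lemma D_has_sum: "(f has_sum s) A \<Longrightarrow> ((\<lambda>j. D (f j) n) has_sum D s n) A"
  by (rule has_sum_bounded_additive[where C = 1]) (auto simp: D_add D_bound)

text \<open>Coefficient form of \<open>(S + \<delta>\<^sub>0)\<^sup>k (S + \<delta>\<^sub>0)\<^sup>l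
  = (S + \<delta>\<^sub>0)\<^sup>k\<^sup>+\<^sup>l\<close> for arbitrary integers: Vandermonde's
  identity handles \<open>\<delta>\<^sub>0\<close>, the product rule \<open>D_mult\<close> the
  remaining variables.\<close>

lemma sum_D_gchoose:
  "(\<Sum>(u, v) | u + v = n.
      ((of_int k gchoose Poly_Mapping.lookup u 0) * D x (tail_exponent u)) *
      ((of_int l gchoose Poly_Mapping.lookup v 0) * D y (tail_exponent v))) =
    (of_int (k + l) gchoose Poly_Mapping.lookup n 0) * D (x * y) (tail_exponent n)"
proof -
  let ?N = "Poly_Mapping.lookup n 0"
  have "(\<Sum>(u, v) | u + v = n.
      ((of_int k gchoose Poly_Mapping.lookup u 0) * D x (tail_exponent u)) *
      ((of_int l gchoose Poly_Mapping.lookup v 0) * D y (tail_exponent v))) =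
    (\<Sum>q\<in>{0..?N}. \<Sum>(u, v) | u + v = tail_exponent n.
      ((of_int k gchoose q) * D x u) * ((of_int l gchoose (?N - q)) * D y v))"
    by (rule sum_exponent_split)
  also have "\<dots> = (\<Sum>q\<in>{0..?N}. (of_int k gchoose q) * (of_int l gchoose (?N - q)) *
      D (x * y) (tail_exponent n))"
    by (simp add: D_mult sum_distrib_left case_prod_unfold mult_ac)
  also have "\<dots> = (of_int (k + l) gchoose ?N) * D (x * y) (tail_exponent n)"
    by (simp add: sum_distrib_right[symmetric] gbinomial_Vandermonde)
  finally show ?thesis .
qed

text \<open>Substituting \<open>j \<mapsto> j + u\<^sub>0\<close> in the \<open>(u, v)\<close>-term of the Cauchy product reduces the claim to
  Vandermonde's identity.\<close>

lemma taylor_mult: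
  assumes summable: "\<And>k. ((\<lambda>j. absv (f j * g (k - j))) \<longlongrightarrow> 0) cofinite"
  shows "taylor (\<lambda>i. \<Sum>\<^sub>\<infinity>j. f j * g (i - j)) = thick_mult (taylor f) (taylor g)"
proof (intro ext)
  fix i and n :: "nat \<Rightarrow>\<^sub>0 nat"
  let ?l = "\<lambda>u :: nat \<Rightarrow>\<^sub>0 nat. Poly_Mapping.lookup u 0"
  let ?A = "{(u, v). u + v = n}"
  \<comment> \<open>Only the coefficient of \<open>S\<^sup>M\<close> in the product of
    \<open>f\<close> and \<open>g\<close> contributes to the term in
    \<open>S\<^sup>i \<delta>\<^sup>n\<close> of its expansion.\<close>
  define M where "M = i + int (?l n)"
  define T where "T = (\<lambda>j (u, v).
    ((of_int j gchoose ?l u) * D (f j) (tail_exponent u)) *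
    ((of_int (M - j) gchoose ?l v) * D (g (M - j)) (tail_exponent v)))"
  define s where "s = (\<lambda>uv. \<Sum>\<^sub>\<infinity>j. T j uv)"
  have T_bound: "absv (T j uv) \<le> absv (f j * g (M - j))" for j uv
  proof -
    obtain u v where uv: "uv = (u, v)" by force
    have "absv (T j uv) \<le> (1 * absv (f j)) * (1 * absv (g (M - j)))"
      unfolding T_def uv prod.case absv_mult
      by (intro mult_mono D_bound absv_gchoose mult_nonneg_nonneg) auto
    then show ?thesis by (simp add: absv_mult)
  qed
  \<comment> \<open>Each \<open>(u, v)\<close>-part is dominated by the terms of the Cauchy product
    and so is summable on its own. This permits a different shift of \<open>j\<close> for each
    pair.\<close>
  have T_sum: "((\<lambda>j. T j uv) has_sum s uv) UNIV" for uv
  proof -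
    have "((\<lambda>j. absv (T j uv)) \<longlongrightarrow> 0) cofinite"
      by (rule tendsto_sandwich[OF _ _ tendsto_const summable[of M]]) (auto simp: T_bound)
    then show ?thesis
      unfolding s_def by (intro has_sum_infsum summable_on_if_tendsto_0)
  qed
  have T_total: "((\<lambda>j. \<Sum>uv\<in>?A. T j uv) has_sum (\<Sum>uv\<in>?A. s uv)) UNIV"
    by (rule has_sum_sum_nonarch) (rule T_sum)
  have "((\<lambda>j. f j * g (M - j)) has_sum (\<Sum>\<^sub>\<infinity>j. f j * g (M - j))) UNIV"
    by (intro has_sum_infsum summable_on_if_tendsto_0 summable)
  then have "((\<lambda>j. (of_int M gchoose ?l n) * D (f j * g (M - j)) (tail_exponent n)) has_sum
      (of_int M gchoose ?l n) * D (\<Sum>\<^sub>\<infinity>j. f j * g (M - j)) (tail_exponent n)) UNIV"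
    by (intro has_sum_mult_left_nonarch D_has_sum)
  moreover have "(of_int M gchoose ?l n) * D (f j * g (M - j)) (tail_exponent n) = (\<Sum>uv\<in>?A. T j uv)" for j
    unfolding T_def using sum_D_gchoose[where k = j and l = "M - j" and n = n] by simp
  ultimately have "((\<lambda>j. \<Sum>uv\<in>?A. T j uv) has_sum
      taylor (\<lambda>i. \<Sum>\<^sub>\<infinity>j. f j * g (i - j)) i n) UNIV"
    by (simp only: taylor_def Let_def M_def)
  then have lhs: "(\<Sum>uv\<in>?A. s uv) = taylor (\<lambda>i. \<Sum>\<^sub>\<infinity>j. f j * g (i - j)) i n"
    using T_total has_sum_unique by blast
  have "((\<lambda>j. \<Sum>uv\<in>?A. T (j + int (?l (fst uv))) uv) has_sum (\<Sum>uv\<in>?A. s uv)) UNIV"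
  proof (rule has_sum_sum_nonarch)
    fix uv :: "(nat \<Rightarrow>\<^sub>0 nat) \<times> (nat \<Rightarrow>\<^sub>0 nat)"
    have "bij_betw (\<lambda>j. j + int (?l (fst uv))) UNIV UNIV"
      by (rule bij_betwI[where g = "\<lambda>j. j - int (?l (fst uv))"]) auto
    then show "((\<lambda>j. T (j + int (?l (fst uv))) uv) has_sum s uv) UNIV"
      using T_sum[of uv] by (subst has_sum_reindex_bij_betw)
  qed
  moreover have "(\<Sum>uv\<in>?A. T (j + int (?l (fst uv))) uv) =
      (\<Sum>(u, v) | u + v = n. taylor f j u * taylor g (i - j) v)" for j
  proof (rule sum.cong[OF refl])
    fix uv assume "uv \<in> ?A"
    then obtain u v where uv: "uv = (u, v)" "u + v = n" by auto
    have "M - (j + int (?l u)) = i - j + int (?l v)"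
      using uv(2) by (auto simp: M_def lookup_add)
    then show "T (j + int (?l (fst uv))) uv = (case uv of (u, v) \<Rightarrow> taylor f j u * taylor g (i - j) v)"
      by (simp only: T_def uv(1) prod.case fst_conv taylor_def Let_def)
  qed
  ultimately have "thick_mult (taylor f) (taylor g) i n = (\<Sum>uv\<in>?A. s uv)"
    unfolding thick_mult_def by (auto intro: infsumI)
  with lhs show "taylor (\<lambda>i. \<Sum>\<^sub>\<infinity>j. f j * g (i - j)) i n = thick_mult (taylor f) (taylor g) i n"
    by simp
qed

section \<open>Convergence and Gauss norms of the expansion\<close>

text \<open>The number \<rho> bounds both \<open>r 0 / s\<close> and the other radii, so that the
  logarithmic and the non-logarithmic case are treated together. The power of \<open>s\<close> in
  the bound for \<open>\<delta>\<^sub>0\<close> turns \<open>s powi i\<close> into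
  \<open>s powi k\<close> with \<open>k = i + n\<^sub>0\<close>; the powers of \<rho> add up to the
  degree.\<close>

lemma thick_term_taylor_le:
  assumes s: "0 < s" and r: "\<And>j. j \<in> {0..m} \<Longrightarrow> 0 \<le> r j"
    and r0: "r 0 \<le> \<rho> * s" and rj: "\<And>j. j \<in> {1..m} \<Longrightarrow> r j \<le> \<rho>" and "0 \<le> \<rho>"
  shows "thick_term m s r (taylor f) (i, n) \<le>
    absv (f (i + int (Poly_Mapping.lookup n 0))) * s powi (i + int (Poly_Mapping.lookup n 0)) *
    \<rho> ^ (\<Sum>j\<in>{0..m}. Poly_Mapping.lookup n j)"
proof -
  let ?l = "Poly_Mapping.lookup n"
  have "(\<Prod>j\<in>{0..m}. r j ^ ?l j) = r 0 ^ ?l 0 * (\<Prod>j\<in>{1..m}. r j ^ ?l j)"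
    by (simp add: prod.atLeast_Suc_atMost)
  also have "\<dots> \<le> (\<rho> * s) ^ ?l 0 * (\<Prod>j\<in>{1..m}. \<rho> ^ ?l j)"
    using r r0 rj s \<open>0 \<le> \<rho>\<close>
    by (intro mult_mono power_mono prod_mono prod_nonneg conjI zero_le_power) auto
  also have "\<dots> = s ^ ?l 0 * \<rho> ^ (\<Sum>j\<in>{0..m}. ?l j)"
    by (simp add: sum.atLeast_Suc_atMost power_add power_sum power_mult_distrib)
  finally have P: "(\<Prod>j\<in>{0..m}. r j ^ ?l j) \<le> s ^ ?l 0 * \<rho> ^ (\<Sum>j\<in>{0..m}. ?l j)" .
  have "thick_term m s r (taylor f) (i, n) \<le>
      absv (f (i + int (?l 0))) * s powi i * (s ^ ?l 0 * \<rho> ^ (\<Sum>j\<in>{0..m}. ?l j))"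
    unfolding thick_term_def prod.case using s r
    by (intro mult_mono P absv_taylor_le prod_nonneg) auto
  also have "\<dots> = absv (f (i + int (?l 0))) * s powi (i + int (?l 0)) * \<rho> ^ (\<Sum>j\<in>{0..m}. ?l j)"
    using s by (simp add: power_int_add)
  finally show ?thesis .
qed

lemma thick_term_nonneg:
  assumes "0 < s" "\<And>j. j \<in> {0..m} \<Longrightarrow> 0 \<le> r j"
  shows "0 \<le> thick_term m s r F x"
  using assms by (auto simp: thick_term_def case_prod_unfold intro!: mult_nonneg_nonneg prod_nonneg)

text \<open>A term of size at least \<open>e\<close> forces the \<open>k\<close>-th term of
  \<open>f\<close> to have size at least \<open>e\<close>, which leaves finitely many
  \<open>k\<close>. As the terms of \<open>f\<close> are bounded and \<rho> is less than 1, the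
  degree of \<open>n\<close> is bounded too. The pair \<open>(k, n)\<close> determines
  \<open>(i, n)\<close>.\<close>

lemma thick_term_taylor_tendsto:
  assumes s: "0 < s" and r: "\<And>j. j \<in> {0..m} \<Longrightarrow> 0 \<le> r j"
    and r0: "r 0 \<le> \<rho> * s" and rj: "\<And>j. j \<in> {1..m} \<Longrightarrow> r j \<le> \<rho>" and \<rho>: "0 \<le> \<rho>" "\<rho> < 1"
    and f: "((\<lambda>i. absv (f i) * s powi i) \<longlongrightarrow> 0) cofinite"
  shows "(thick_term m s r (taylor f) \<longlongrightarrow> 0) cofinite"
proof -
  let ?d = "\<lambda>n. \<Sum>j\<in>{0..m}. Poly_Mapping.lookup n j"
  let ?c = "\<lambda>i. absv (f i) * s powi i"
  have c0: "0 \<le> ?c k" for k using s by simp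
  obtain C where C: "\<And>k. ?c k \<le> C"
    using tendsto_0_cofinite_bdd_above[OF f] by (auto simp: bdd_above_def)
  have "finite {x. e \<le> thick_term m s r (taylor f) x}" if e: "0 < e" for e
  proof -
    \<comment> \<open>\<open>C\<close> may be \<open>0\<close>, hence the divisor
      \<open>C + 1\<close>.\<close>
    have "0 < C + 1" using C[of 0] c0[of 0] by linarith
    obtain N where N: "\<rho> ^ N < e / (C + 1)"
      using real_arch_pow_inv[of "e / (C + 1)" \<rho>] e \<open>0 < C + 1\<close> \<rho> by auto
    define X where "X = {k. e \<le> ?c k}"
    define Y where "Y = {n :: nat \<Rightarrow>\<^sub>0 nat. Poly_Mapping.keys n \<subseteq> {0..m} \<and> ?d n \<le> N}"
    have "finite X" unfolding X_def
      using f e by (subst (asm) tendsto_0_cofinite_iff) (auto intro: c0)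
    moreover have "finite Y" unfolding Y_def by (rule finite_exponents_bounded) simp
    moreover have "{x. e \<le> thick_term m s r (taylor f) x} \<subseteq>
        (\<lambda>(k, n). (k - int (Poly_Mapping.lookup n 0), n)) ` (X \<times> Y)"
    proof
      fix x assume x: "x \<in> {x. e \<le> thick_term m s r (taylor f) x}"
      obtain i n where xe: "x = (i, n)" by force
      define k where "k = i + int (Poly_Mapping.lookup n 0)"
      have "e \<le> ?c k * \<rho> ^ ?d n"
        using x thick_term_taylor_le[of s r \<rho> f i n] s r r0 rj \<rho> unfolding xe k_def by simp
      then have 1: "e \<le> ?c k" "e \<le> C * \<rho> ^ ?d n"
        using mult_left_le[of "\<rho> ^ ?d n" "?c k"] c0[of k] power_le_one[of \<rho> "?d n"] \<rho>
          mult_right_mono[OF C[of k], of "\<rho> ^ ?d n"] by auto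
      have "?d n \<le> N"
      proof (rule ccontr)
        assume "\<not> ?d n \<le> N"
        then have "\<rho> ^ ?d n \<le> \<rho> ^ N" using \<rho> by (intro power_decreasing) auto
        have "e \<le> (C + 1) * \<rho> ^ ?d n" using 1(2) \<rho> by (simp add: algebra_simps add_increasing)
        also have "\<dots> \<le> (C + 1) * \<rho> ^ N" using \<open>\<rho> ^ ?d n \<le> \<rho> ^ N\<close> \<open>0 < C + 1\<close> by simp
        also have "\<dots> < e" using N \<open>0 < C + 1\<close> by (simp add: field_simps)
        finally show False by simp
      qed
      moreover have "Poly_Mapping.keys n \<subseteq> {0..m}"
      proof (rule taylor_keys)
        show "taylor f i n \<noteq> 0" using x e by (auto simp: xe thick_term_def)
      qed
      ultimately have "k \<in> X" "n \<in> Y" using 1 by (auto simp: X_def Y_def)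
      then show "x \<in> (\<lambda>(k, n). (k - int (Poly_Mapping.lookup n 0), n)) ` (X \<times> Y)"
        by (intro image_eqI[where x = "(k, n)"]) (auto simp: xe k_def)
    qed
    ultimately show ?thesis by (meson finite_SigmaI finite_imageI finite_subset)
  qed
  then show ?thesis
    by (subst tendsto_0_cofinite_iff) (auto intro!: thick_term_nonneg s r)
qed

lemma bdd_above_thick_term_taylor:
  assumes s: "0 < s" and r: "\<And>j. j \<in> {0..m} \<Longrightarrow> 0 \<le> r j"
    and r0: "r 0 \<le> \<rho> * s" and rj: "\<And>j. j \<in> {1..m} \<Longrightarrow> r j \<le> \<rho>" and \<rho>: "0 \<le> \<rho>" "\<rho> < 1"
    and f: "((\<lambda>i. absv (f i) * s powi i) \<longlongrightarrow> 0) cofinite"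
  shows "bdd_above (range (thick_term m s r (taylor f)))"
  using assms by (intro tendsto_0_cofinite_bdd_above thick_term_taylor_tendsto[of s r \<rho>]) auto

text \<open>A priori the keys of \<open>n\<close> may lie beyond \<open>m\<close>, where the sum
  does not see them; a nonzero coefficient excludes this.\<close>

lemma degree_pos:
  assumes "taylor f i n \<noteq> 0" "n \<noteq> 0"
  shows "1 \<le> (\<Sum>j\<in>{0..m}. Poly_Mapping.lookup n j)"
proof -
  obtain j where j: "j \<in> Poly_Mapping.keys n" using assms(2) by (metis all_not_in_conv keys_eq_empty)
  then have "j \<in> {0..m}" using taylor_keys[OF assms(1)] by auto
  then have "Poly_Mapping.lookup n j \<le> (\<Sum>j\<in>{0..m}. Poly_Mapping.lookup n j)"
    by (intro member_le_sum) auto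
  with j show ?thesis by (simp add: in_keys_iff)
qed

lemma taylor_diff_pi_star: "(taylor f - pi_star f) i n = (if n = 0 then 0 else taylor f i n)"
  by (simp add: pi_star_def)

text \<open>Subtracting \<open>pi_star f\<close> removes exactly the terms with
  \<open>n = 0\<close>. Every remaining nonzero term has positive degree and so gains a factor
  \<rho>.\<close>

lemma thick_gauss_norm_taylor_diff_le:
  assumes s: "0 < s" and r: "\<And>j. j \<in> {0..m} \<Longrightarrow> 0 \<le> r j"
    and r0: "r 0 \<le> \<rho> * s" and rj: "\<And>j. j \<in> {1..m} \<Longrightarrow> r j \<le> \<rho>" and \<rho>: "0 \<le> \<rho>" "\<rho> < 1"
    and f: "((\<lambda>i. absv (f i) * s powi i) \<longlongrightarrow> 0) cofinite"
  shows "thick_gauss_norm m s r (taylor f - pi_star f) \<le> \<rho> * annulus_norm s f"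
  unfolding thick_gauss_norm_def
proof (rule cSUP_least)
  fix x :: "int \<times> (nat \<Rightarrow>\<^sub>0 nat)"
  obtain i n where x: "x = (i, n)" by force
  let ?d = "\<Sum>j\<in>{0..m}. Poly_Mapping.lookup n j"
  have le: "absv (f k) * s powi k \<le> annulus_norm s f" for k
    unfolding annulus_norm_def
    by (rule cSUP_upper) (auto intro: tendsto_0_cofinite_bdd_above[OF f])
  have nonneg: "0 \<le> annulus_norm s f"
    using le[of 0] s by (meson absv_nonneg mult_nonneg_nonneg order_trans zero_le_power_int less_imp_le)
  show "thick_term m s r (taylor f - pi_star f) x \<le> \<rho> * annulus_norm s f"
  proof (cases "(taylor f - pi_star f) i n = 0")
    case True
    then show ?thesis using nonneg \<rho> by (simp add: x thick_term_def del: minus_apply)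
  next
    case False
    then have n: "n \<noteq> 0" "taylor f i n \<noteq> 0" by (auto simp: taylor_diff_pi_star simp del: minus_apply split: if_splits)
    define k where "k = i + int (Poly_Mapping.lookup n 0)"
    have "thick_term m s r (taylor f - pi_star f) x = thick_term m s r (taylor f) (i, n)"
      using n by (simp add: x thick_term_def pi_star_def)
    also have "\<dots> \<le> absv (f k) * s powi k * \<rho> ^ ?d"
      unfolding k_def using s r r0 rj \<rho>(1) by (rule thick_term_taylor_le)
    also have "\<dots> \<le> annulus_norm s f * \<rho> ^ 1"
      using degree_pos[OF n(2,1)] \<rho> nonneg by (intro mult_mono le power_decreasing) auto
    finally show ?thesis by (simp add: mult.commute)
  qed
qed simp

text \<open>The terms with \<open>n = 0\<close> are those of \<open>f\<close>, and every other term
  is dominated by one of them.\<close>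

lemma thick_gauss_norm_taylor:
  assumes s: "0 < s" and r: "\<And>j. j \<in> {0..m} \<Longrightarrow> 0 \<le> r j"
    and r0: "r 0 \<le> \<rho> * s" and rj: "\<And>j. j \<in> {1..m} \<Longrightarrow> r j \<le> \<rho>" and \<rho>: "0 \<le> \<rho>" "\<rho> < 1"
    and f: "((\<lambda>i. absv (f i) * s powi i) \<longlongrightarrow> 0) cofinite"
  shows "thick_gauss_norm m s r (taylor f) = annulus_norm s f"
proof (rule antisym)
  have le: "absv (f k) * s powi k \<le> annulus_norm s f" for k
    unfolding annulus_norm_def
    by (rule cSUP_upper) (auto intro: tendsto_0_cofinite_bdd_above[OF f])
  show "thick_gauss_norm m s r (taylor f) \<le> annulus_norm s f"
    unfolding thick_gauss_norm_def
  proof (rule cSUP_least)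
    fix x :: "int \<times> (nat \<Rightarrow>\<^sub>0 nat)"
    obtain i n where x: "x = (i, n)" by force
    define k where "k = i + int (Poly_Mapping.lookup n 0)"
    have "thick_term m s r (taylor f) x \<le>
        absv (f k) * s powi k * \<rho> ^ (\<Sum>j\<in>{0..m}. Poly_Mapping.lookup n j)"
      unfolding k_def x using s r r0 rj \<rho>(1) by (rule thick_term_taylor_le)
    also have "\<dots> \<le> absv (f k) * s powi k * 1"
      using s \<rho> by (intro mult_left_mono power_le_one) auto
    finally show "thick_term m s r (taylor f) x \<le> annulus_norm s f" using le[of k] by linarith
  qed simp
  show "annulus_norm s f \<le> thick_gauss_norm m s r (taylor f)"
    unfolding annulus_norm_def
  proof (rule cSUP_least)
    fix i
    have "absv (f i) * s powi i = thick_term m s r (taylor f) (i, 0)"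
      by (simp add: thick_term_def)
    also have "\<dots> \<le> thick_gauss_norm m s r (taylor f)"
      unfolding thick_gauss_norm_def
      using assms by (intro cSUP_upper bdd_above_thick_term_taylor[of s r \<rho>]) auto
    finally show "absv (f i) * s powi i \<le> thick_gauss_norm m s r (taylor f)" .
  qed simp
qed

text \<open>In the general estimate \<open>\<delta>\<^sub>0\<close> contributes only
  \<open>s powr (a - 1)\<close> because it replaces a factor \<open>S\<close>. For an integral power
  series no negative power of \<open>S\<close> arises in the expansion, so
  \<open>s powi i \<le> 1\<close>, and every variable contributes its full radius
  \<open>s powr a\<close>.\<close>

lemma TS_norm_taylor_diff_le_int:
  assumes s: "0 < s" "s < 1" and "0 < a" and f: "f \<in> int_series"
  shows "TS_norm m a s (taylor f - pi_star f) \<le> s powr a"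
  unfolding TS_norm_def thick_gauss_norm_def
proof (rule cSUP_least)
  fix x :: "int \<times> (nat \<Rightarrow>\<^sub>0 nat)"
  obtain i n where x: "x = (i, n)" by force
  let ?d = "\<Sum>j\<in>{0..m}. Poly_Mapping.lookup n j"
  show "thick_term m s (\<lambda>j. s powr a) (taylor f - pi_star f) x \<le> s powr a"
  proof (cases "(taylor f - pi_star f) i n = 0")
    case True
    then show ?thesis by (simp add: x thick_term_def del: minus_apply)
  next
    case False
    then have n: "n \<noteq> 0" "taylor f i n \<noteq> 0" by (auto simp: taylor_diff_pi_star simp del: minus_apply split: if_splits)
    define N where "N = Poly_Mapping.lookup n 0"
    define k where "k = i + int N"
    have nz: "(of_int k gchoose N :: 'k) \<noteq> 0" "f k \<noteq> 0"
      using n(2) by (auto simp: taylor_def Let_def k_def N_def simp del: of_int_add)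
    have "0 \<le> k" using nz(2) f by (force simp: int_series_def)
    \<comment> \<open>For natural \<open>k\<close> the generalized binomial coefficient is the
      ordinary one, which vanishes if \<open>N > k\<close>. This gives
      \<open>i = k - N \<ge> 0\<close>.\<close>
    then obtain q where q: "k = int q" by (metis nonneg_int_cases)
    have "(of_nat (q choose N) :: 'k) \<noteq> 0"
      using nz(1) by (simp add: q binomial_gbinomial)
    then have "N \<le> q" by (metis binomial_eq_0 not_less of_nat_0)
    then have i: "0 \<le> i" using q by (simp add: k_def)
    have "absv (taylor f i n) \<le> 1"
      using absv_taylor_le[of f i n] f by (auto simp: int_series_def integers_def intro: order_trans)
    moreover have "s powi i \<le> 1"
      using s i by (simp add: power_int_def power_le_one)
    moreover have "(s powr a) ^ ?d \<le> (s powr a) ^ 1"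
      using degree_pos[OF n(2,1)] s \<open>0 < a\<close> by (intro power_decreasing) (auto simp: powr_le1)
    ultimately have "absv (taylor f i n) * s powi i * (s powr a) ^ ?d \<le> 1 * 1 * (s powr a) ^ 1"
      using s by (intro mult_mono) auto
    then show ?thesis
      using n by (simp add: x thick_term_def pi_star_def power_sum)
  qed
qed simp

section \<open>The expansion as a ring homomorphism\<close>

text \<open>Up to the constant factor \<open>s powi k\<close>, the family is the product of a null
  family and a bounded one.\<close>

lemma absv_convolution_tendsto:
  assumes s: "0 < s"
    and f: "((\<lambda>i. absv (f i) * s powi i) \<longlongrightarrow> 0) cofinite"
    and g: "((\<lambda>i. absv (g i) * s powi i) \<longlongrightarrow> 0) cofinite"
  shows "((\<lambda>j. absv (f j * g (k - j))) \<longlongrightarrow> 0) cofinite"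
proof -
  obtain C where C: "\<And>j. absv (g j) * s powi j \<le> C"
    using tendsto_0_cofinite_bdd_above[OF g] by (auto simp: bdd_above_def)
  have "absv (f j * g (k - j)) \<le> absv (f j) * s powi j * (C / s powi k)" for j
  proof -
    have "absv (f j * g (k - j)) =
        absv (f j) * s powi j * ((absv (g (k - j)) * s powi (k - j)) / s powi k)"
      using s by (simp add: absv_mult power_int_diff)
    also have "\<dots> \<le> absv (f j) * s powi j * (C / s powi k)"
      using s C by (intro mult_left_mono divide_right_mono) auto
    finally show ?thesis .
  qed
  moreover have "((\<lambda>j. absv (f j) * s powi j * (C / s powi k)) \<longlongrightarrow> 0) cofinite"
    using tendsto_mult_right[OF f, of "C / s powi k"] by simp
  ultimately show ?thesis
    by - (rule tendsto_sandwich[where f = "\<lambda>_. 0"], auto)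
qed

text \<open>The condition on \<open>X\<close> places each polyradius over a radius in
  \<open>I\<close> and supplies the \<rho> of the estimates above. It may vary with the polyradius:
  over \<open>{\<eta>\<^sub>0..<1}\<close> it has to approach \<open>1\<close> together with
  \<open>s\<close>.\<close>

lemma taylor_ring_hom:
  assumes I: "I \<noteq> {}"
    and X: "\<And>s r. (s, r) \<in> X \<Longrightarrow> s \<in> I \<and> (\<forall>j\<in>{0..m}. 0 \<le> r j) \<and>
      (\<exists>\<rho>. 0 \<le> \<rho> \<and> \<rho> < 1 \<and> r 0 \<le> \<rho> * s \<and> (\<forall>j\<in>{1..m}. r j \<le> \<rho>))"
    and pos: "\<And>s. s \<in> I \<Longrightarrow> 0 < s"
  shows "taylor \<in> ring_hom (annulus_ring I) (analytic_ring m X)"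
proof (rule ring_hom_memI)
  fix f :: "'k series" assume f: "f \<in> carrier (annulus_ring I)"
  have "(thick_term m s r (taylor f) \<longlongrightarrow> 0) cofinite" if sr: "(s, r) \<in> X" for s r
  proof -
    obtain \<rho> where "0 \<le> \<rho>" "\<rho> < 1" "r 0 \<le> \<rho> * s" "\<forall>j\<in>{1..m}. r j \<le> \<rho>"
      using X[OF sr] by auto
    moreover have "((\<lambda>i. absv (f i) * s powi i) \<longlongrightarrow> 0) cofinite"
      using f X[OF sr] by (auto simp: annulus_ring_def series_ring_def)
    ultimately show ?thesis
      using X[OF sr] pos by (intro thick_term_taylor_tendsto[of s r \<rho>]) auto
  qed
  moreover have "\<forall>i n. taylor f i n \<noteq> 0 \<longrightarrow> Poly_Mapping.keys n \<subseteq> {0..m}"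
    using taylor_keys by blast
  ultimately show "taylor f \<in> carrier (analytic_ring m X)"
    by (auto simp: analytic_ring_def thick_ring_def simp del: atLeastAtMost_iff)
  fix g :: "'k series" assume g: "g \<in> carrier (annulus_ring I)"
  show "taylor (f \<oplus>\<^bsub>annulus_ring I\<^esub> g) = taylor f \<oplus>\<^bsub>analytic_ring m X\<^esub> taylor g"
    by (simp add: annulus_ring_def analytic_ring_def series_ring_def thick_ring_def taylor_add)
  obtain s where s: "s \<in> I" using I by auto
  have "taylor (\<lambda>i. \<Sum>\<^sub>\<infinity>j. f j * g (i - j)) = thick_mult (taylor f) (taylor g)"
    using f g s by (intro taylor_mult absv_convolution_tendsto[of s])
      (auto simp: annulus_ring_def series_ring_def intro: pos)
  then show "taylor (f \<otimes>\<^bsub>annulus_ring I\<^esub> g) = taylor f \<otimes>\<^bsub>analytic_ring m X\<^esub> taylor g"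
    by (simp add: annulus_ring_def analytic_ring_def series_ring_def thick_ring_def)
qed (simp add: annulus_ring_def analytic_ring_def series_ring_def thick_ring_def taylor_one)

end

section \<open>The expansion of constants\<close>

definition series_monom :: "int \<Rightarrow> 'k::complete_nonarch_field \<Rightarrow> 'k series" where
  "series_monom k x = (\<lambda>i. if i = k then x else 0)"

lemma series_const_conv_monom: "series_const x = series_monom 0 x"
  by (simp add: series_const_def series_monom_def)

lemma series_S_conv_monom: "series_S = series_monom 1 1"
  by (simp add: series_S_def series_monom_def)

lemma series_monom_convolution:
  "(\<lambda>i. \<Sum>\<^sub>\<infinity>j. series_monom k x j * series_monom l y (i - j)) = series_monom (k + l) (x * y)"
proof
  fix i
  have "(\<Sum>\<^sub>\<infinity>j. series_monom k x j * series_monom l y (i - j)) =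
      series_monom k x k * series_monom l y (i - k)"
    by (rule infsum_single_support) (simp add: series_monom_def)
  then show "(\<Sum>\<^sub>\<infinity>j. series_monom k x j * series_monom l y (i - j)) = series_monom (k + l) (x * y) i"
    by (auto simp: series_monom_def)
qed

text \<open>\<open>\<delta>\<^sub>j\<close> involves only \<open>S\<^sup>0\<close>, which makes the
  infinite sum collapse, whatever \<open>F\<close> is.\<close>

lemma thick_mult_delta:
  "thick_mult (thick_delta j) F i n =
    (\<Sum>(u, v) | u + v = n. if u = Poly_Mapping.single j 1 then F i v else 0)"
proof -
  have "thick_mult (thick_delta j) F i n = (\<Sum>(u, v) | u + v = n. thick_delta j 0 u * F (i - 0) v)"
    unfolding thick_mult_def
    by (rule infsum_single_support) (auto simp: thick_delta_def intro!: sum.neutral)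
  also have "\<dots> = (\<Sum>(u, v) | u + v = n. if u = Poly_Mapping.single j 1 then F i v else 0)"
    by (rule sum.cong) (auto simp: thick_delta_def)
  finally show ?thesis .
qed

lemma absv_thick_mult_delta_le:
  assumes "\<And>v. absv (F i v) \<le> c"
  shows "absv (thick_mult (thick_delta j) F i n) \<le> c"
  unfolding thick_mult_delta
proof (rule absv_sum_le)
  show "0 \<le> c" using assms[of 0] absv_nonneg order_trans by blast
  then show "absv (case x of (u, v) \<Rightarrow> if u = Poly_Mapping.single j 1 then F i v else 0) \<le> c" for x
    using assms by (auto split: prod.split)
qed

lemma thick_mult_delta_nonzero:
  assumes "thick_mult (thick_delta j) F i n \<noteq> 0"
  obtains v where "Poly_Mapping.single j 1 + v = n" "F i v \<noteq> 0"
proof -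
  obtain x where "x \<in> {(u, v). u + v = n}"
      "(case x of (u, v) \<Rightarrow> if u = Poly_Mapping.single j 1 then F i v else 0) \<noteq> 0"
    using assms unfolding thick_mult_delta by (rule sum.not_neutral_contains_not_neutral)
  then show ?thesis using that by (auto split: if_splits)
qed

lemma keys_single_add_subset:
  assumes "Poly_Mapping.single j (1::nat) + v = n"
  shows "Poly_Mapping.keys n \<subseteq> insert j (Poly_Mapping.keys v)"
  using keys_add[of "Poly_Mapping.single j (1::nat)" v] unfolding assms by auto

lemma integers_0: "0 \<in> integers" and integers_1: "1 \<in> integers"
  by (simp_all add: integers_def)

lemma integers_add: "x \<in> integers \<Longrightarrow> y \<in> integers \<Longrightarrow> x + y \<in> integers"
  using absv_add[of x y] by (simp add: integers_def)

lemma integers_mult: "x \<in> integers \<Longrightarrow> y \<in> integers \<Longrightarrow> x * y \<in> integers"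
  by (simp add: integers_def absv_mult mult_le_one)

lemma integers_of_nat: "of_nat n \<in> integers"
  by (simp add: integers_def absv_of_nat)

lemma integers_power: "x \<in> integers \<Longrightarrow> x ^ n \<in> integers"
  by (simp add: integers_def absv_power power_le_one)

lemma series_monom_in_int_series: "x \<in> integers \<Longrightarrow> 0 \<le> k \<Longrightarrow> series_monom k x \<in> int_series"
  by (auto simp: int_series_def series_monom_def integers_0)

section \<open>Images of integral constants\<close>

locale pi_tilde = cohen_ring p m red b B
  for p m :: nat and red :: "'k::complete_nonarch_field \<Rightarrow> 'r::field" and b B +
  fixes P :: "'k series \<Rightarrow> 'k thick_series"
  assumes pi_tilde: "is_pi_tilde p m red B P"
begin

lemma P_hom: "P \<in> ring_hom (series_ring int_series) (thick_ring (int_thick_series m))"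
  using pi_tilde by (simp add: is_pi_tilde_def)

lemma P_mult:
  "\<lbrakk>f \<in> int_series; g \<in> int_series\<rbrakk> \<Longrightarrow> P (\<lambda>i. \<Sum>\<^sub>\<infinity>j. f j * g (i - j)) = thick_mult (P f) (P g)"
  using ring_hom_mult[OF P_hom, of f g] by (simp add: series_ring_def thick_ring_def)

lemma P_add:
  "\<lbrakk>f \<in> int_series; g \<in> int_series\<rbrakk> \<Longrightarrow> P (\<lambda>i. f i + g i) = thick_add (P f) (P g)"
  using ring_hom_add[OF P_hom, of f g] by (simp add: series_ring_def thick_ring_def)

lemma P_one: "P (series_const 1) = pi_star (series_const 1)"
  using ring_hom_one[OF P_hom] by (simp add: series_ring_def thick_ring_def)

lemma P_witt_linear:
  "\<lbrakk>c \<in> witt_integers p red; f \<in> int_series\<rbrakk> \<Longrightarrow> P (series_scale c f) = thick_scale c (P f)"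
  using pi_tilde by (simp add: is_pi_tilde_def)

lemma P_S: "P series_S = thick_add (pi_star series_S) (thick_delta 0)"
  using pi_tilde by (simp add: is_pi_tilde_def)

lemma P_continuous: "continuous_on int_series P"
  using pi_tilde by (simp add: is_pi_tilde_def)

lemma P_const_expansion:
  assumes "g \<in> integers"
  obtains H where "\<And>j. j \<in> {1..m} \<Longrightarrow> H j \<in> int_delta_series m"
    "\<And>i n. P (series_const g) i n = pi_star (series_const g) i n +
      (\<Sum>j\<in>{1..m}. thick_mult (thick_delta j) (thick_scale g (H j)) i n)"
proof -
  have "\<exists>H. (\<forall>j\<in>{1..m}. H j \<in> int_delta_series m) \<and>
      P (series_const g) - pi_star (series_const g) =
        (\<lambda>i n. \<Sum>j\<in>{1..m}. thick_mult (thick_delta j) (thick_scale g (H j)) i n)"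
    using pi_tilde assms unfolding is_pi_tilde_def by blast
  then obtain H where H: "\<forall>j\<in>{1..m}. H j \<in> int_delta_series m"
    "P (series_const g) - pi_star (series_const g) =
        (\<lambda>i n. \<Sum>j\<in>{1..m}. thick_mult (thick_delta j) (thick_scale g (H j)) i n)"
    by blast
  have "P (series_const g) i n = pi_star (series_const g) i n +
      (\<Sum>j\<in>{1..m}. thick_mult (thick_delta j) (thick_scale g (H j)) i n)" for i n
    using fun_cong[OF fun_cong[OF H(2), of i], of n] by (simp add: algebra_simps)
  with H(1) that show ?thesis by blast
qed

text \<open>Multiplication by \<open>\<delta>\<^sub>j\<close> adds at most \<open>j\<close> to the
  keys, so the support condition on the series \<open>H j\<close> carries over.\<close>

lemma P_const_nonzero:
  assumes g: "g \<in> integers" and nz: "P (series_const g) i n \<noteq> 0"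
  shows "i = 0 \<and> Poly_Mapping.keys n \<subseteq> {1..m}"
proof -
  obtain H where H: "\<And>j. j \<in> {1..m} \<Longrightarrow> H j \<in> int_delta_series m"
    "\<And>i n. P (series_const g) i n = pi_star (series_const g) i n +
      (\<Sum>j\<in>{1..m}. thick_mult (thick_delta j) (thick_scale g (H j)) i n)"
    using P_const_expansion[OF g] by blast
  consider "pi_star (series_const g) i n \<noteq> 0"
    | "(\<Sum>j\<in>{1..m}. thick_mult (thick_delta j) (thick_scale g (H j)) i n) \<noteq> 0"
    using nz H(2)[of i n] by force
  then show ?thesis
  proof cases
    case 1
    then show ?thesis by (auto simp: pi_star_def series_const_def split: if_splits)
  next
    case 2
    then obtain j where j: "j \<in> {1..m}" "thick_mult (thick_delta j) (thick_scale g (H j)) i n \<noteq> 0"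
      by (rule sum.not_neutral_contains_not_neutral)
    from j(2) obtain v where v: "Poly_Mapping.single j 1 + v = n" "thick_scale g (H j) i v \<noteq> 0"
      by (rule thick_mult_delta_nonzero)
    from v(2) have "H j i v \<noteq> 0" by (auto simp: thick_scale_def)
    then have "i = 0 \<and> Poly_Mapping.keys v \<subseteq> {1..m}"
      using H(1)[OF j(1)] unfolding int_delta_series_def by blast
    then show ?thesis using keys_single_add_subset[OF v(1)] j(1) by blast
  qed
qed

text \<open>The factor \<open>g\<close> in each correction term yields the bound
  \<open>absv g\<close> instead of \<open>1\<close>. Being homogeneous, this bound survives the
  division by powers of \<open>p\<close> by which the coefficients are extended to all
  constants.\<close>

lemma absv_P_const_le:
  assumes g: "g \<in> integers"
  shows "absv (P (series_const g) i n) \<le> absv g"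
proof -
  obtain H where H: "\<And>j. j \<in> {1..m} \<Longrightarrow> H j \<in> int_delta_series m"
    "\<And>i n. P (series_const g) i n = pi_star (series_const g) i n +
      (\<Sum>j\<in>{1..m}. thick_mult (thick_delta j) (thick_scale g (H j)) i n)"
    using P_const_expansion[OF g] by blast
  have "absv (thick_mult (thick_delta j) (thick_scale g (H j)) i n) \<le> absv g"
    if "j \<in> {1..m}" for j
  proof (rule absv_thick_mult_delta_le)
    fix v
    show "absv (thick_scale g (H j) i v) \<le> absv g"
      using H(1)[OF that]
      by (auto simp: int_delta_series_def integers_def thick_scale_def absv_mult intro: mult_left_le)
  qed
  then have "absv (\<Sum>j\<in>{1..m}. thick_mult (thick_delta j) (thick_scale g (H j)) i n) \<le> absv g"
    by (intro absv_sum_le) auto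
  moreover have "absv (pi_star (series_const g) i n) \<le> absv g"
    by (auto simp: pi_star_def series_const_def)
  ultimately show ?thesis
    unfolding H(2) by (meson absv_add max.boundedI order_trans)
qed

text \<open>The correction terms are multiples of some \<open>\<delta>\<^sub>j\<close>, hence have
  no constant term.\<close>

lemma P_const_exponent_0:
  assumes g: "g \<in> integers"
  shows "P (series_const g) 0 0 = g"
proof -
  obtain H where H:
    "\<And>i n. P (series_const g) i n = pi_star (series_const g) i n +
      (\<Sum>j\<in>{1..m}. thick_mult (thick_delta j) (thick_scale g (H j)) i n)"
    using P_const_expansion[OF g] by metis
  have "thick_mult (thick_delta j) F 0 0 = 0" for j and F :: "'k thick_series"
  proof (rule ccontr)
    assume "thick_mult (thick_delta j) F 0 0 \<noteq> 0"
    then obtain v where v: "Poly_Mapping.single j 1 + v = (0 :: nat \<Rightarrow>\<^sub>0 nat)"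
      by (rule thick_mult_delta_nonzero)
    show False
      using arg_cong[OF v, of "\<lambda>w. Poly_Mapping.lookup w j"] by (simp add: lookup_add)
  qed
  then show ?thesis unfolding H by (simp add: pi_star_def series_const_def)
qed

lemma P_const_add:
  assumes "x \<in> integers" "y \<in> integers"
  shows "P (series_const (x + y)) i n = P (series_const x) i n + P (series_const y) i n"
proof -
  have "series_const (x + y) = (\<lambda>i. series_const x i + series_const y i)"
    by (auto simp: series_const_def)
  then show ?thesis
    using assms by (simp add: P_add series_const_conv_monom series_monom_in_int_series thick_add_def)
qed

lemma P_const_mult:
  assumes x: "x \<in> integers" and y: "y \<in> integers"
  shows "P (series_const (x * y)) 0 n =
    (\<Sum>(u, v) | u + v = n. P (series_const x) 0 u * P (series_const y) 0 v)"
proof -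
  have "P (series_const (x * y)) = thick_mult (P (series_const x)) (P (series_const y))"
    using P_mult[of "series_monom 0 x" "series_monom 0 y"] assms
    by (simp add: series_monom_convolution series_const_conv_monom series_monom_in_int_series)
  then have "P (series_const (x * y)) 0 n = thick_mult (P (series_const x)) (P (series_const y)) 0 n"
    by simp
  also have "\<dots> =
      (\<Sum>(u, v) | u + v = n. P (series_const x) 0 u * P (series_const y) (0 - 0) v)"
    unfolding thick_mult_def
    using P_const_nonzero[OF x] by (intro infsum_single_support) (force intro!: sum.neutral)
  finally show ?thesis by simp
qed

text \<open>This follows from additivity alone and is applied to the powers of \<open>p\<close> that
  serve as denominators.\<close>

lemma P_const_of_nat_mult:
  assumes "x \<in> integers"
  shows "P (series_const (of_nat q * x)) i n = of_nat q * P (series_const x) i n"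
proof (induction q)
  case 0
  show ?case using P_const_add[OF integers_0 integers_0, of i n] by simp
next
  case (Suc q)
  have "of_nat (Suc q) * x = x + of_nat q * x" by (simp add: algebra_simps)
  then show ?case
    using Suc assms by (simp add: P_const_add integers_mult integers_of_nat algebra_simps)
qed

lemma P_const_power_mult:
  assumes "x \<in> integers"
  shows "P (series_const (of_nat p ^ k * x)) i n = of_nat p ^ k * P (series_const x) i n"
  using P_const_of_nat_mult[OF assms, of "p ^ k" i n] by simp

section \<open>Extension of the coefficients from the integers to the field\<close>

lemma p_nonzero: "(of_nat p :: 'k) \<noteq> 0"
  using p_prime by (auto simp: prime_gt_0_nat)

text \<open>As \<open>p\<close> lies in the maximal ideal, its absolute value is less than
  \<open>1\<close> and the powers tend to \<open>0\<close>.\<close>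

lemma ex_integral_multiple: "\<exists>k. of_nat p ^ k * (x :: 'k) \<in> integers"
proof -
  have "(of_nat p :: 'k) \<in> (*) (of_nat p) ` integers"
    by (rule image_eqI[of _ _ 1]) (auto simp: integers_1)
  then have p: "absv (of_nat p :: 'k) < 1" by (simp add: maximal_ideal[symmetric])
  obtain k where "absv (of_nat p :: 'k) ^ k < 1 / (absv x + 1)"
    using real_arch_pow_inv[OF _ p, of "1 / (absv x + 1)"] by (auto simp: add_nonneg_pos)
  then have "absv (of_nat p :: 'k) ^ k * (absv x + 1) < 1"
    using add_nonneg_pos[OF absv_nonneg zero_less_one, of x] by (simp add: field_simps)
  moreover have "absv (of_nat p :: 'k) ^ k * absv x \<le> absv (of_nat p :: 'k) ^ k * (absv x + 1)"
    by (intro mult_left_mono) auto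
  ultimately have "absv (of_nat p ^ k * x) \<le> 1"
    unfolding absv_mult absv_power by linarith
  then show ?thesis by (auto simp: integers_def)
qed

text \<open>The integral constant \<open>p ^ k * x\<close> is expanded and the result divided by
  \<open>p ^ k\<close>. By \<open>const_coeff_eq\<close> the choice of \<open>k\<close> is
  immaterial.\<close>

definition const_coeff :: "'k \<Rightarrow> (nat \<Rightarrow>\<^sub>0 nat) \<Rightarrow> 'k" where
  "const_coeff x n = (let k = (SOME k. of_nat p ^ k * x \<in> integers) in
    P (series_const (of_nat p ^ k * x)) 0 n / of_nat p ^ k)"

text \<open>Two admissible exponents \<open>k\<close> and \<open>l\<close> are compared through the
  image of \<open>p ^ (k + l) * x\<close>.\<close>

lemma const_coeff_eq:
  assumes k: "of_nat p ^ k * x \<in> integers"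
  shows "const_coeff x n = P (series_const (of_nat p ^ k * x)) 0 n / of_nat p ^ k"
proof -
  define l where "l = (SOME k. of_nat p ^ k * x \<in> integers)"
  have l: "of_nat p ^ l * x \<in> integers" unfolding l_def by (rule someI_ex) (rule ex_integral_multiple)
  have "of_nat p ^ l * P (series_const (of_nat p ^ k * x)) 0 n =
      P (series_const (of_nat p ^ l * (of_nat p ^ k * x))) 0 n"
    using P_const_power_mult[OF k] by simp
  also have "\<dots> = of_nat p ^ k * P (series_const (of_nat p ^ l * x)) 0 n"
    using P_const_power_mult[OF l, of k] by (simp add: mult_ac)
  finally show ?thesis
    unfolding const_coeff_def Let_def l_def[symmetric] using p_nonzero by (simp add: field_simps)
qed

lemma const_coeff_integers: "x \<in> integers \<Longrightarrow> const_coeff x n = P (series_const x) 0 n"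
  using const_coeff_eq[of 0 x n] by simp

lemma ex_common_integral_multiple:
  obtains k where "of_nat p ^ k * (x :: 'k) \<in> integers" "of_nat p ^ k * (y :: 'k) \<in> integers"
proof -
  obtain k where "of_nat p ^ k * x \<in> integers" using ex_integral_multiple by blast
  moreover obtain l where "of_nat p ^ l * y \<in> integers" using ex_integral_multiple by blast
  ultimately have "of_nat p ^ l * (of_nat p ^ k * x) \<in> integers" "of_nat p ^ k * (of_nat p ^ l * y) \<in> integers"
    by (auto intro: integers_mult integers_power integers_of_nat)
  then show ?thesis using that[of "k + l"] by (simp add: power_add mult_ac)
qed

text \<open>The laws hold for the integral constants \<open>p ^ k * x\<close> and
  \<open>p ^ k * y\<close> with a common \<open>k\<close>. Division by \<open>p ^ k\<close>, for
  products by \<open>p ^ (k + k)\<close>, carries them over to \<open>x\<close> and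
  \<open>y\<close>.\<close>

sublocale constant_expansion m const_coeff
proof
  fix x y :: 'k and n :: "nat \<Rightarrow>\<^sub>0 nat"
  let ?p = "of_nat p :: 'k"
  obtain k where k: "?p ^ k * x \<in> integers" "?p ^ k * y \<in> integers"
    by (rule ex_common_integral_multiple)
  have "?p ^ k * (x + y) \<in> integers"
    using k by (simp add: distrib_left integers_add)
  then show "const_coeff (x + y) n = const_coeff x n + const_coeff y n"
    using k by (simp add: const_coeff_eq[of k] distrib_left P_const_add add_divide_distrib)
  have "(?p ^ k * x) * (?p ^ k * y) \<in> integers" using k by (rule integers_mult)
  moreover have e: "(?p ^ k * x) * (?p ^ k * y) = ?p ^ (k + k) * (x * y)"
    by (simp add: power_add mult_ac)
  ultimately have "const_coeff (x * y) n = P (series_const ((?p ^ k * x) * (?p ^ k * y))) 0 n / ?p ^ (k + k)"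
    by (simp only: const_coeff_eq)
  also have "\<dots> = (\<Sum>(u, v) | u + v = n. const_coeff x u * const_coeff y v)"
    unfolding P_const_mult[OF k] sum_divide_distrib
    by (rule sum.cong) (auto simp: const_coeff_eq[OF k(1)] const_coeff_eq[OF k(2)] power_add)
  finally show "const_coeff (x * y) n = (\<Sum>(u, v) | u + v = n. const_coeff x u * const_coeff y v)" .
  show "absv (const_coeff x n) \<le> absv x"
  proof -
    have "absv (?p ^ k * const_coeff x n) \<le> absv (?p ^ k * x)"
      using absv_P_const_le[OF k(1), of 0 n] p_nonzero by (simp add: const_coeff_eq[OF k(1)])
    moreover have "absv ?p \<noteq> 0" unfolding absv_eq_0_iff by (rule p_nonzero)
    then have "0 < absv ?p ^ k" using absv_nonneg[of ?p] by (intro zero_less_power) linarith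
    ultimately show ?thesis by (simp only: absv_mult absv_power mult_le_cancel_left_pos)
  qed
  show "const_coeff x 0 = x"
    using p_nonzero by (simp add: const_coeff_eq[OF k(1)] P_const_exponent_0[OF k(1)])
  show "const_coeff 1 n = 0" if "n \<noteq> 0"
    using that by (simp add: const_coeff_integers integers_1 P_one pi_star_def)
  show "Poly_Mapping.keys n \<subseteq> {1..m}" if "const_coeff x n \<noteq> 0"
    using that P_const_nonzero[OF k(1)] by (auto simp: const_coeff_eq[OF k(1)])
qed

lemma const_coeff_witt_integers:
  assumes c: "c \<in> witt_integers p red"
  shows "const_coeff (c * x) n = c * const_coeff x n"
proof -
  let ?p = "of_nat p :: 'k"
  obtain k where k: "?p ^ k * x \<in> integers" "?p ^ k * (c * x) \<in> integers"
    by (rule ex_common_integral_multiple)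
  have "series_const (?p ^ k * (c * x)) = series_scale c (series_const (?p ^ k * x))"
    by (auto simp: series_const_def series_scale_def)
  then have "P (series_const (?p ^ k * (c * x))) = thick_scale c (P (series_const (?p ^ k * x)))"
    using P_witt_linear[OF c] k(1) by (simp add: series_const_conv_monom series_monom_in_int_series)
  then show ?thesis
    by (simp add: const_coeff_eq[OF k(1)] const_coeff_eq[OF k(2)] thick_scale_def)
qed

text \<open>With \<open>c = y / z\<close>, multiplication by \<open>z\<close> reduces the claim to
  linearity over the Witt integers.\<close>

lemma const_coeff_witt_field:
  assumes "c \<in> witt_field p red"
  shows "const_coeff (c * x) n = c * const_coeff x n"
proof -
  obtain y z where c: "c = y / z" "y \<in> witt_integers p red" "z \<in> witt_integers p red" "z \<noteq> 0"
    using assms by (auto simp: witt_field_def)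
  have "z * const_coeff (c * x) n = const_coeff (y * x) n"
    using c by (simp add: const_coeff_witt_integers[symmetric])
  also have "\<dots> = y * const_coeff x n" using c(2) by (rule const_coeff_witt_integers)
  finally have "const_coeff (c * x) n = (y * const_coeff x n) / z"
    using c(4) by (metis nonzero_mult_div_cancel_left)
  also have "\<dots> = c * const_coeff x n" by (simp add: c(1))
  finally show ?thesis .
qed

section \<open>Agreement with \<pi>-tilde on integral power series\<close>

text \<open>Only \<open>k = 1\<close> contributes, and \<open>1 gchoose N\<close> vanishes for
  \<open>N \<ge> 2\<close>. The cases \<open>N = 0\<close> and \<open>N = 1\<close> give
  \<open>S\<close> and \<open>\<delta>\<^sub>0\<close>.\<close>

lemma taylor_S: "taylor series_S = P series_S"
proof (intro ext)
  fix i and n :: "nat \<Rightarrow>\<^sub>0 nat"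
  define N where "N = Poly_Mapping.lookup n 0"
  have one: "const_coeff 1 v = (if v = 0 then 1 else 0)" for v
    using D_one[of v] D_exponent_0[of 1] by auto
  have n: "n = (if N = 0 then 0 else Poly_Mapping.single 0 N)" if "tail_exponent n = 0"
  proof (rule poly_mapping_eqI)
    fix j
    show "Poly_Mapping.lookup n j = Poly_Mapping.lookup (if N = 0 then 0 else Poly_Mapping.single 0 N) j"
      using arg_cong[OF that, of "\<lambda>w. Poly_Mapping.lookup w j"]
      by (auto simp: N_def lookup_tail_exponent lookup_single when_def split: if_splits)
  qed
  have t: "tail_exponent (Poly_Mapping.single 0 k) = 0" for k
    by (rule poly_mapping_eqI) (simp add: lookup_tail_exponent lookup_single)
  have P: "P series_S i n =
      (if i = 1 \<and> n = 0 \<or> i = 0 \<and> n = Poly_Mapping.single 0 1 then 1 else 0)"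
    unfolding P_S by (auto simp: thick_add_def pi_star_def thick_delta_def series_S_def)
  have T: "taylor series_S i n =
      (if i + int N = 1 \<and> tail_exponent n = 0 then 1 gchoose N else 0)"
    by (auto simp: taylor_def series_S_def one N_def Let_def simp del: of_int_add)
  consider "N = 0" | "N = 1" | "2 \<le> N" by linarith
  then show "taylor series_S i n = P series_S i n"
  proof cases
    case 1
    then have "n \<noteq> Poly_Mapping.single 0 1" by (auto simp: N_def)
    moreover have "tail_exponent n = 0 \<longleftrightarrow> n = 0" using 1 n by (metis tail_exponent_0)
    ultimately show ?thesis using 1 unfolding P T by auto
  next
    case 2
    then have "n \<noteq> 0" by (auto simp: N_def)
    moreover have "tail_exponent n = 0 \<longleftrightarrow> n = Poly_Mapping.single 0 1"
      using 2 n t[of 1] by (metis zero_neq_one)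
    ultimately show ?thesis using 2 unfolding P T by auto
  next
    case 3
    then have "n \<noteq> 0" "n \<noteq> Poly_Mapping.single 0 1" by (auto simp: N_def)
    moreover have "(1 gchoose N :: 'k) = 0"
      using 3 binomial_gbinomial[of 1 N, where 'a = 'k] by (simp add: binomial_eq_0)
    ultimately show ?thesis unfolding P T by auto
  qed
qed

text \<open>For \<open>N = 0\<close> both sides have the coefficients of the expansion of
  \<open>x\<close>. For \<open>N > 0\<close> both vanish: images of constants do not involve
  \<open>\<delta>\<^sub>0\<close>, and \<open>0 gchoose N = 0\<close>.\<close>

lemma taylor_const:
  assumes x: "x \<in> integers"
  shows "taylor (series_const x) = P (series_const x)"
proof (intro ext)
  fix i and n :: "nat \<Rightarrow>\<^sub>0 nat"
  define N where "N = Poly_Mapping.lookup n 0"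
  show "taylor (series_const x) i n = P (series_const x) i n"
  proof (cases "N = 0")
    case True
    then have "tail_exponent n = n" by (simp add: N_def tail_exponent_def)
    then show ?thesis
      using True P_const_nonzero[OF x, of i n]
      by (auto simp: taylor_def N_def[symmetric] series_const_def const_coeff_integers[OF x] Let_def)
  next
    case False
    then have "0 \<in> Poly_Mapping.keys n" by (simp add: N_def in_keys_iff)
    then have "P (series_const x) i n = 0"
      by (meson P_const_nonzero[OF x] atLeastAtMost_iff not_one_le_zero subsetD)
    moreover have "taylor (series_const x) i n = 0"
      using False by (simp add: taylor_def N_def[symmetric] series_const_def Let_def gbinomial_0_left
        del: of_int_add)
    ultimately show ?thesis by simp
  qed
qed

text \<open>Both maps are multiplicative and agree on constants and on \<open>S\<close>; the
  induction multiplies by \<open>S\<close>.\<close>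

lemma taylor_monom:
  assumes x: "x \<in> integers"
  shows "taylor (series_monom (int k) x) = P (series_monom (int k) x)"
proof (induction k)
  case 0
  then show ?case using taylor_const[OF x] by (simp add: series_const_conv_monom)
next
  case (Suc k)
  let ?f = "series_monom (int k) x" and ?S = "series_monom 1 1 :: 'k series"
  have e: "series_monom (int (Suc k)) x = (\<lambda>i. \<Sum>\<^sub>\<infinity>j. ?f j * ?S (i - j))"
    by (simp add: series_monom_convolution add.commute)
  \<comment> \<open>A monomial leaves at most one nonzero term in the Cauchy product, so the
    convergence required by \<open>taylor_mult\<close> is trivial.\<close>
  have "((\<lambda>j. absv (?f j * ?S (i - j))) \<longlongrightarrow> 0) cofinite" for i
    by (rule tendsto_eventually)
      (auto simp: eventually_cofinite series_monom_def intro: finite_subset[of _ "{int k}"])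
  then have "taylor (series_monom (int (Suc k)) x) = thick_mult (taylor ?f) (taylor ?S)"
    unfolding e by (rule taylor_mult)
  also have "\<dots> = thick_mult (P ?f) (P ?S)"
    using Suc taylor_S by (simp add: series_S_conv_monom)
  also have "\<dots> = P (series_monom (int (Suc k)) x)"
    unfolding e using x by (intro P_mult[symmetric] series_monom_in_int_series) (auto simp: integers_1)
  finally show ?case .
qed

lemma taylor_truncation:
  assumes f: "f \<in> int_series"
  shows "taylor (\<lambda>i. if i < int N then f i else 0) = P (\<lambda>i. if i < int N then f i else 0)"
proof (induction N)
  case 0
  \<comment> \<open>As \<open>f\<close> has no negative powers of \<open>S\<close>, this truncation
    is zero, written as a monomial with coefficient \<open>0\<close>.\<close>
  have "(\<lambda>i. if i < int 0 then f i else 0) = series_monom (int 0) 0"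
    using f by (auto simp: int_series_def series_monom_def)
  then show ?case using taylor_monom[OF integers_0, of 0] by simp
next
  case (Suc N)
  let ?g = "\<lambda>i. if i < int N then f i else 0" and ?h = "series_monom (int N) (f (int N))"
  have fN: "f (int N) \<in> integers" using f by (auto simp: int_series_def)
  have "(\<lambda>i. if i < int (Suc N) then f i else 0) = (\<lambda>i. ?g i + ?h i)"
    by (auto simp: series_monom_def)
  moreover have "?g \<in> int_series" using f by (auto simp: int_series_def integers_0)
  ultimately show ?case
    using Suc taylor_monom[OF fN, of N] fN
    by (simp add: taylor_add P_add series_monom_in_int_series)
qed

text \<open>The truncations of \<open>f\<close> converge to \<open>f\<close> in the product
  topology, so continuity determines \<open>P f\<close> from them. A coefficient of
  \<open>taylor f\<close> depends on a single coefficient of \<open>f\<close> and hence is attained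
  by every sufficiently long truncation.\<close>

lemma taylor_int_series:
  assumes f: "f \<in> int_series"
  shows "taylor f = P f"
proof (intro ext)
  fix i and n :: "nat \<Rightarrow>\<^sub>0 nat"
  let ?t = "\<lambda>N i. if i < int N then f i else 0"
  have "limitin (product_topology (\<lambda>_. euclidean) UNIV) ?t f sequentially"
  proof (subst limitin_componentwise, intro conjI ballI)
    fix j :: int
    show "limitin euclidean (\<lambda>N. ?t N j) (f j) sequentially"
      unfolding limitin_canonical_iff
      by (rule tendsto_eventually, rule eventually_sequentiallyI[of "nat (j + 1)"]) auto
  qed auto
  then have t: "?t \<longlonglongrightarrow> f"
    by (simp only: euclidean_product_topology limitin_canonical_iff)
  have "continuous_on int_series (\<lambda>g. P g i n)"
    by (rule continuous_on_product_then_coordinatewise[OF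
        continuous_on_product_then_coordinatewise[OF P_continuous]])
  then have "(\<lambda>N. P (?t N) i n) \<longlonglongrightarrow> P f i n"
    by (rule continuous_on_tendsto_compose[OF _ t])
      (use f in \<open>auto simp: int_series_def integers_0 intro!: always_eventually\<close>)
  moreover have "(\<lambda>N. P (?t N) i n) \<longlonglongrightarrow> taylor f i n"
  proof (rule tendsto_eventually, rule eventually_sequentiallyI)
    \<comment> \<open>The bound on \<open>N\<close> makes the truncation retain the one relevant
      index, \<open>i + n\<^sub>0\<close>.\<close>
    fix N assume "nat (i + int (Poly_Mapping.lookup n 0) + 1) \<le> N"
    then show "P (?t N) i n = taylor f i n"
      unfolding taylor_truncation[OF f, symmetric] by (auto simp: taylor_def Let_def)
  qed
  ultimately show "taylor f i n = P f i n"
    using LIMSEQ_unique by blast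
qed

section \<open>The induced homomorphisms on annuli and their norm estimates\<close>

lemma induced_hom_taylor:
  assumes "I \<noteq> {}"
    and "\<And>s r. (s, r) \<in> X \<Longrightarrow> s \<in> I \<and> (\<forall>j\<in>{0..m}. 0 \<le> r j) \<and>
      (\<exists>\<rho>. 0 \<le> \<rho> \<and> \<rho> < 1 \<and> r 0 \<le> \<rho> * s \<and> (\<forall>j\<in>{1..m}. r j \<le> \<rho>))"
    and "\<And>s. s \<in> I \<Longrightarrow> 0 < s"
  shows "induced_hom (witt_field p red) P (annulus_ring I) (analytic_ring m X) taylor"
  unfolding induced_hom_def
  by (intro conjI ballI taylor_ring_hom taylor_scale const_coeff_witt_field taylor_int_series
      Delta_star_taylor assms)

lemma powr_diff_one_mult: "0 < s \<Longrightarrow> s powr (a - 1) * s = s powr (a :: real)"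
  by (simp add: powr_diff)

text \<open>The witness for \<rho> is \<open>s powr (a - 1)\<close>, since
  \<open>\<delta>\<^sub>0\<close> is allowed the radius
  \<open>s powr a = s powr (a - 1) * s\<close>. It is less than \<open>1\<close> because
  \<open>1 < a\<close>.\<close>

lemma induced_hom_TS:
  assumes "1 < a" "I \<noteq> {}" "I \<subseteq> {0<..<1}"
  shows "induced_hom (witt_field p red) P (annulus_ring I) (analytic_ring m (TS m a I)) taylor"
proof (rule induced_hom_taylor)
  fix s r assume sr: "(s, r) \<in> TS m a I"
  then have s: "0 < s" "s < 1" using assms(3) by (auto simp: TS_def)
  have "s powr a \<le> s powr (a - 1)" using s by (intro powr_mono') auto
  then have "r j \<le> s powr (a - 1)" if "j \<in> {1..m}" for j
    using sr that by (force simp: TS_def)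
  moreover have "r 0 \<le> s powr (a - 1) * s" unfolding powr_diff_one_mult[OF s(1)]
    using sr by (simp add: TS_def)
  moreover have "s powr (a - 1) < 1" using s assms(1) by (simp add: powr01_less_one)
  moreover have "s \<in> I" "\<forall>j\<in>{0..m}. 0 \<le> r j" using sr by (auto simp: TS_def)
  ultimately show "s \<in> I \<and> (\<forall>j\<in>{0..m}. 0 \<le> r j) \<and>
      (\<exists>\<rho>. 0 \<le> \<rho> \<and> \<rho> < 1 \<and> r 0 \<le> \<rho> * s \<and> (\<forall>j\<in>{1..m}. r j \<le> \<rho>))"
    by (intro conjI exI[of _ "s powr (a - 1)"] ballI) simp_all
qed (use assms in auto)

text \<open>The smaller radius of \<open>\<delta>\<^sub>0\<close> compensates for the division by
  \<open>s\<close>, so \<rho> can be \<open>s powr a\<close>, which is less than \<open>1\<close> as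
  soon as \<open>0 < a\<close>.\<close>

lemma induced_hom_TS_log:
  assumes "0 < a" "I \<noteq> {}" "I \<subseteq> {0<..<1}"
  shows "induced_hom (witt_field p red) P (annulus_ring I) (analytic_ring m (TS_log m a I)) taylor"
proof (rule induced_hom_taylor)
  fix s r assume sr: "(s, r) \<in> TS_log m a I"
  then have s: "0 < s" "s < 1" using assms(3) by (auto simp: TS_log_def)
  have nonneg: "0 \<le> r j" if "j \<in> {0..m}" for j
    using sr that by (cases "j = 0") (auto simp: TS_log_def)
  have "s powr a < 1" using s assms(1) by (simp add: powr01_less_one)
  then show "s \<in> I \<and> (\<forall>j\<in>{0..m}. 0 \<le> r j) \<and>
      (\<exists>\<rho>. 0 \<le> \<rho> \<and> \<rho> < 1 \<and> r 0 \<le> \<rho> * s \<and> (\<forall>j\<in>{1..m}. r j \<le> \<rho>))"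
    using sr s nonneg by (intro conjI exI[of _ "s powr a"])
      (auto simp: TS_log_def powr_add)
qed (use assms in auto)

lemma TS_norm_taylor:
  assumes "1 < a" "0 < s" "s < 1" "f \<in> carrier (annulus_ring {s})"
  shows "TS_norm m a s (taylor f - pi_star f) \<le> s powr (a - 1) * annulus_norm s f"
    and "TS_norm m a s (taylor f) = annulus_norm s f"
proof -
  have "s powr a \<le> s powr (a - 1) * s" using assms by (simp add: powr_diff_one_mult)
  moreover have "s powr a \<le> s powr (a - 1)" using assms by (intro powr_mono') auto
  moreover have "s powr (a - 1) < 1" using assms by (simp add: powr01_less_one)
  moreover have "((\<lambda>i. absv (f i) * s powi i) \<longlongrightarrow> 0) cofinite"
    using assms(4) by (simp add: annulus_ring_def series_ring_def)
  ultimately show "TS_norm m a s (taylor f - pi_star f) \<le> s powr (a - 1) * annulus_norm s f"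
    and "TS_norm m a s (taylor f) = annulus_norm s f"
    unfolding TS_norm_def using assms(2)
    by (intro thick_gauss_norm_taylor_diff_le thick_gauss_norm_taylor[where \<rho> = "s powr (a - 1)"]; simp)+
qed

lemma TS_log_norm_taylor:
  assumes "0 < a" "0 < s" "s < 1" "f \<in> carrier (annulus_ring {s})"
  shows "TS_log_norm m a s (taylor f - pi_star f) \<le> s powr a * annulus_norm s f"
    and "TS_log_norm m a s (taylor f) = annulus_norm s f"
proof -
  have "s powr (a + 1) \<le> s powr a * s" using assms by (simp add: powr_add)
  moreover have "s powr a < 1" using assms by (simp add: powr01_less_one)
  moreover have "((\<lambda>i. absv (f i) * s powi i) \<longlongrightarrow> 0) cofinite"
    using assms(4) by (simp add: annulus_ring_def series_ring_def)
  ultimately show "TS_log_norm m a s (taylor f - pi_star f) \<le> s powr a * annulus_norm s f"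
    and "TS_log_norm m a s (taylor f) = annulus_norm s f"
    unfolding TS_log_norm_def using assms(2)
    by (intro thick_gauss_norm_taylor_diff_le thick_gauss_norm_taylor[where \<rho> = "s powr a"]; simp)+
qed

end

theorem theorem3p2p6:
  fixes p m :: nat
    and red :: "'k::complete_nonarch_field \<Rightarrow> 'r::field"
    and b :: "nat \<Rightarrow> 'r" and B :: "nat \<Rightarrow> 'k"
    and P :: "'k series \<Rightarrow> 'k thick_series"
    and a \<eta>\<^sub>0 :: real
  assumes "cohen_ring p m red b B"
    and "is_pi_tilde p m red B P"
    and "a \<in> \<rat>"
    and "0 < \<eta>\<^sub>0" and "\<eta>\<^sub>0 < 1"
  shows
    "(1 < a \<longrightarrow>
      (\<exists>\<Phi> \<Phi>'.
        induced_hom (witt_field p red) P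
          (annulus_ring {\<eta>\<^sub>0..<1}) (analytic_ring m (TS m a {\<eta>\<^sub>0..<1})) \<Phi> \<and>
        (\<forall>\<eta>\<in>{\<eta>\<^sub>0..<1}.
          induced_hom (witt_field p red) P
            (annulus_ring {\<eta>}) (analytic_ring m (TS m a {\<eta>})) (\<Phi>' \<eta>) \<and>
          (\<forall>g\<in>carrier (annulus_ring {\<eta>\<^sub>0..<1}). \<Phi>' \<eta> g = \<Phi> g) \<and>
          (\<forall>g\<in>carrier (annulus_ring {\<eta>}).
            TS_norm m a \<eta> (\<Phi>' \<eta> g - pi_star g) \<le> \<eta> powr (a - 1) * annulus_norm \<eta> g \<and>
            TS_norm m a \<eta> (\<Phi>' \<eta> g) = annulus_norm \<eta> g) \<and>
          (\<forall>g\<in>carrier (annulus_ring {\<eta>}) \<inter> int_series.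
            TS_norm m a \<eta> (\<Phi>' \<eta> g - pi_star g) \<le> \<eta> powr a)))) \<and>
     (0 < a \<longrightarrow>
      (\<exists>\<Phi> \<Phi>'.
        induced_hom (witt_field p red) P
          (annulus_ring {\<eta>\<^sub>0..<1}) (analytic_ring m (TS_log m a {\<eta>\<^sub>0..<1})) \<Phi> \<and>
        (\<forall>\<eta>\<in>{\<eta>\<^sub>0..<1}.
          induced_hom (witt_field p red) P
            (annulus_ring {\<eta>}) (analytic_ring m (TS_log m a {\<eta>})) (\<Phi>' \<eta>) \<and>
          (\<forall>g\<in>carrier (annulus_ring {\<eta>\<^sub>0..<1}). \<Phi>' \<eta> g = \<Phi> g) \<and>
          (\<forall>g\<in>carrier (annulus_ring {\<eta>}).
            TS_log_norm m a \<eta> (\<Phi>' \<eta> g - pi_star g) \<le> \<eta> powr a * annulus_norm \<eta> g \<and>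
            TS_log_norm m a \<eta> (\<Phi>' \<eta> g) = annulus_norm \<eta> g))))"
proof -
  interpret pi_tilde p m red b B P
    using assms(1,2) by (simp add: pi_tilde_def pi_tilde_axioms_def)
  have I: "{\<eta>\<^sub>0..<1} \<noteq> {}" "{\<eta>\<^sub>0..<1} \<subseteq> {0<..<1}" using assms(4,5) by auto
  have \<eta>: "0 < \<eta>" "\<eta> < 1" "{\<eta>} \<noteq> {}" "{\<eta>} \<subseteq> {0<..<1}" if "\<eta> \<in> {\<eta>\<^sub>0..<1}" for \<eta>
    using that assms(4) by auto
  show ?thesis
  proof (intro conjI impI)
    assume a: "1 < a"
    then have "0 < a" by simp
    \<comment> \<open>Restriction between domains leaves the coefficients unchanged, so
      \<open>taylor\<close> serves both as \<open>\<Phi>\<close> and as every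
      \<open>\<Phi>' \<eta>\<close>.\<close>
    show "\<exists>\<Phi> \<Phi>'. induced_hom (witt_field p red) P
        (annulus_ring {\<eta>\<^sub>0..<1}) (analytic_ring m (TS m a {\<eta>\<^sub>0..<1})) \<Phi> \<and> (\<forall>\<eta>\<in>{\<eta>\<^sub>0..<1}.
          induced_hom (witt_field p red) P
            (annulus_ring {\<eta>}) (analytic_ring m (TS m a {\<eta>})) (\<Phi>' \<eta>) \<and>
          (\<forall>g\<in>carrier (annulus_ring {\<eta>\<^sub>0..<1}). \<Phi>' \<eta> g = \<Phi> g) \<and>
          (\<forall>g\<in>carrier (annulus_ring {\<eta>}).
            TS_norm m a \<eta> (\<Phi>' \<eta> g - pi_star g) \<le> \<eta> powr (a - 1) * annulus_norm \<eta> g \<and>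
            TS_norm m a \<eta> (\<Phi>' \<eta> g) = annulus_norm \<eta> g) \<and>
          (\<forall>g\<in>carrier (annulus_ring {\<eta>}) \<inter> int_series.
            TS_norm m a \<eta> (\<Phi>' \<eta> g - pi_star g) \<le> \<eta> powr a))"
      by (intro exI[of _ taylor] exI[of _ "\<lambda>_. taylor"] conjI ballI refl
          induced_hom_TS TS_norm_taylor TS_norm_taylor_diff_le_int a I \<eta> \<open>0 < a\<close>) auto
  next
    assume a: "0 < a"
    show "\<exists>\<Phi> \<Phi>'. induced_hom (witt_field p red) P
        (annulus_ring {\<eta>\<^sub>0..<1}) (analytic_ring m (TS_log m a {\<eta>\<^sub>0..<1})) \<Phi> \<and> (\<forall>\<eta>\<in>{\<eta>\<^sub>0..<1}.
          induced_hom (witt_field p red) P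
            (annulus_ring {\<eta>}) (analytic_ring m (TS_log m a {\<eta>})) (\<Phi>' \<eta>) \<and>
          (\<forall>g\<in>carrier (annulus_ring {\<eta>\<^sub>0..<1}). \<Phi>' \<eta> g = \<Phi> g) \<and>
          (\<forall>g\<in>carrier (annulus_ring {\<eta>}).
            TS_log_norm m a \<eta> (\<Phi>' \<eta> g - pi_star g) \<le> \<eta> powr a * annulus_norm \<eta> g \<and>
            TS_log_norm m a \<eta> (\<Phi>' \<eta> g) = annulus_norm \<eta> g))"
      by (intro exI[of _ taylor] exI[of _ "\<lambda>_. taylor"] conjI ballI refl
          induced_hom_TS_log TS_log_norm_taylor a I \<eta>) auto
  qed
qed

end
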